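(* Let $\mathbf{k}$ be an infinite field and let $\Delta$ be a $(d-1)$-dimensional homology manifold over $\mathbf{k}$ with nonempty boundary $\partial\Delta$. If $\Delta$ is orientable over $\mathbf{k}$, then for all $0\le i<d$, $$h'_{d-i}(\Delta)-\binom{d}{d-i}\beta_{d-i-1}(\Delta)=h'_i(\Delta)-\overline{g}_i(\partial\Delta)-\binom{d}{i}\dim_{\mathbf{k}}\mathrm{Im}\bigl(\psi: H_{i-1}(\Delta)\to H_{i-1}(\Delta,\partial\Delta)\bigr),$$ where $\overline{g}_i(\partial\Delta):=h'_i(\partial\Delta)-h'_{i-1}(\partial\Delta)+\binom{d-1}{i-1}\beta_{i-2}(\partial\Delta)$ and $\psi$ is the map in the long exact homology sequence of the pair $(\Delta,\partial\Delta)$.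
   Context: A simplicial complex on $[n]=\{1,\dots,n\}$ is a collection of subsets (faces) of $[n]$ closed under inclusion and containing all singletons; $\dim F=|F|-1$; it is pure if all maximal faces have the same dimension. The link of a face $F$ is $\mathrm{lk}(F)=\{G\in\Delta: G\cap F=\emptyset,\ G\cup F\in\Delta\}$. A homology manifold over $\mathbf{k}$ of dimension $d-1$ is a pure $(d-1)$-dimensional simplicial complex $\Delta$ such that for every nonempty face $F\in\Delta$, $\tilde H_i(\mathrm{lk}\,F;\mathbf{k})=0$ for $i<d-|F|-1$ and $\tilde H_{d-|F|-1}(\mathrm{lk}\,F;\mathbf{k})$ is isomorphic to $\mathbf{k}$ or $0$. The boundary faces are the nonempty faces $F$ with $\tilde H_{d-|F|-1}(\mathrm{lk}\,F;\mathbf{k})=0$. If there are any, $\partial\Delta$ is the set of boundary faces together with $\emptyset$, and it is a standing assumption that $\partial\Delta$ is a $(d-2)$-dimensional homology manifold without boundary (i.e. with no boundary faces). $\Delta$ is orientable over $\mathbf{k}$ if $(\Delta,\partial\Delta)$ satisfies the usual Poincaré–Lefschetz duality of orientable compact manifolds with boundary; a connected $\Delta$ with boundary is orientable over $\mathbf{k}$ if $H_{d-1}(\Delta,\partial\Delta;\mathbf{k})\cong\mathbf{k}$, in which case $H_{i-1}(\Delta,\partial\Delta)\cong H_{d-i}(\Delta)$. All homology has coefficients in $\mathbf{k}$ (absolute homology reduced), and $\beta_j(\Gamma)=\dim_{\mathbf{k}}\tilde H_j(\Gamma;\mathbf{k})$. For a $(D-1)$-dimensional complex $\Gamma$, with $f_i(\Gamma)$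 the number of $i$-dimensional faces ($f_{-1}=1$), the $h$-numbers are defined by $\sum_{i=0}^{D}h_i\lambda^i=\sum_{i=0}^{D}f_{i-1}\lambda^i(1-\lambda)^{D-i}$, and for a homology manifold $\Gamma$ $$h'_i(\Gamma):=h_i(\Gamma)+\binom{D}{i}\sum_{j=1}^{i-1}(-1)^{i-j-1}\beta_{j-1}(\Gamma),\quad 0\le i\le D.$$ Here $D=d$ for $\Delta$ and $D=d-1$ for $\partial\Delta$; numbers $h'_i$, $\beta_i$ and binomial coefficients with out-of-range negative lower index are $0$. *)

theory Defs
  imports
    "Jordan_Normal_Form.VS_Connect"
    "HOL-Algebra.AbelCoset"
    "HOL-Computational_Algebra.Polynomial"
begin

text \<open>Vector spaces over a field \<open>'k\<close> are \<open>module\<close> records over \<open>class_ring :: 'k ring\<close>. The fields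
  \<open>mult\<close> and \<open>one\<close>, which a \<open>module\<close> record inherits from \<open>ring\<close>, play no role for them.\<close>

definition field_space :: "('k::field, 'k) module" where
  "field_space = \<lparr>carrier = UNIV, mult = (*), one = 1, zero = 0, add = (+), smult = (*)\<rparr>"

definition zero_space :: "('k::field, 'v) module \<Rightarrow> bool" where
  "zero_space V \<longleftrightarrow> carrier V = {\<zero>\<^bsub>V\<^esub>}"

definition iso_spaces :: "('k::field, 'v) module \<Rightarrow> ('k, 'w) module \<Rightarrow> bool" where
  "iso_spaces V W \<longleftrightarrow> (\<exists>f \<in> LinearCombinations.module_hom class_ring V W. bij_betw f (carrier V) (carrier W))"

definition quotient_space :: "('k::field, 'v) module \<Rightarrow> 'v set \<Rightarrow> ('k, 'v set) module" where
  "quotient_space V W =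
    \<lparr>carrier = a_rcosets\<^bsub>V\<^esub> W, mult = undefined, one = undefined, zero = W, add = set_add V,
     smult = (\<lambda>a X. \<Union>x\<in>X. W +>\<^bsub>V\<^esub> (a \<odot>\<^bsub>V\<^esub> x))\<rparr>"

definition simplicial_complex_on :: "nat set \<Rightarrow> nat set set \<Rightarrow> bool" where
  "simplicial_complex_on V K \<longleftrightarrow>
    finite V \<and> K \<subseteq> Pow V \<and> {} \<in> K \<and> (\<forall>F\<in>K. \<forall>G. G \<subseteq> F \<longrightarrow> G \<in> K) \<and> (\<forall>v\<in>V. {v} \<in> K)"

definition facets :: "nat set set \<Rightarrow> nat set set" where
  "facets K = {F \<in> K. \<forall>G\<in>K. F \<subseteq> G \<longrightarrow> G = F}"

text \<open>Throughout, \<open>d\<close> stands for one more than the dimension.\<close>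

definition pure_complex :: "nat \<Rightarrow> nat set set \<Rightarrow> bool" where
  "pure_complex d K \<longleftrightarrow> (\<forall>F \<in> facets K. card F = d)"

definition link :: "nat set set \<Rightarrow> nat set \<Rightarrow> nat set set" where
  "link K F = {G \<in> K. G \<inter> F = {} \<and> G \<union> F \<in> K}"

text \<open>A chain is the function giving the coefficient of each face, faces being oriented by the
  order of the natural numbers. The empty face spans degree -1.\<close>

type_synonym 'k chain = "nat set \<Rightarrow> 'k"

definition chain_space :: "('k::field, 'k chain) module" where
  "chain_space =
    \<lparr>carrier = UNIV, mult = undefined, one = undefined, zero = (\<lambda>F. 0), add = (\<lambda>x y F. x F + y F),
     smult = (\<lambda>a x F. a * x F)\<rparr>"

definition chains :: "int \<Rightarrow> nat set set \<Rightarrow> 'k::field chain set" where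
  "chains i K = {c. \<forall>F. c F \<noteq> 0 \<longrightarrow> F \<in> K \<and> int (card F) = i + 1}"

definition chain_boundary :: "'k::field chain \<Rightarrow> 'k chain" where
  "chain_boundary c =
    (\<lambda>G. \<Sum>F | c F \<noteq> 0. \<Sum>v\<in>F. if F - {v} = G then (-1) ^ card {u \<in> F. u < v} * c F else 0)"

definition relcycles :: "int \<Rightarrow> nat set set \<Rightarrow> nat set set \<Rightarrow> 'k::field chain set" where
  "relcycles i K L = {c \<in> chains i K. chain_boundary c \<in> chains (i - 1) L}"

definition relboundaries :: "int \<Rightarrow> nat set set \<Rightarrow> nat set set \<Rightarrow> 'k::field chain set" where
  "relboundaries i K L =
    {chain_boundary b \<oplus>\<^bsub>chain_space\<^esub> a | b a. b \<in> chains (i + 1) K \<and> a \<in> chains i L}"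

text \<open>For a subcomplex \<open>L\<close> containing the empty face this is the homology of the pair \<open>(K, L)\<close>. Since
  the empty face of \<open>K\<close> is a generator in degree -1, taking \<open>L\<close> to be the void complex \<open>{}\<close> gives
  reduced homology, whereas taking \<open>L = {{}}\<close> gives unreduced homology.\<close>

definition rel_homology ::
    "int \<Rightarrow> nat set set \<Rightarrow> nat set set \<Rightarrow> ('k::field, 'k chain set) module" where
  "rel_homology i K L =
    quotient_space (chain_space\<lparr>carrier := relcycles i K L\<rparr>) (relboundaries i K L)"

abbreviation reduced_homology :: "int \<Rightarrow> nat set set \<Rightarrow> ('k::field, 'k chain set) module" where
  "reduced_homology i K \<equiv> rel_homology i K {}"

abbreviation unreduced_homology :: "int \<Rightarrow> nat set set \<Rightarrow> ('k::field, 'k chain set) module" where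
  "unreduced_homology i K \<equiv> rel_homology i K {{}}"

definition betti :: "'k::field itself \<Rightarrow> int \<Rightarrow> nat set set \<Rightarrow> nat" where
  "betti k i K =
    vectorspace.dim (class_ring :: 'k ring) (reduced_homology i K :: ('k, 'k chain set) module)"

text \<open>The map \<open>H\<^sub>i(K) \<rightarrow> H\<^sub>i(K, L)\<close> of the long exact sequence: the class of a cycle goes to its class
  modulo relative boundaries.\<close>

definition psi ::
    "int \<Rightarrow> nat set set \<Rightarrow> nat set set \<Rightarrow> 'k::field chain set \<Rightarrow> 'k chain set" where
  "psi i K L X = (\<Union>c\<in>X. relboundaries i K L +>\<^bsub>chain_space\<^esub> c)"

definition dim_im_psi :: "'k::field itself \<Rightarrow> int \<Rightarrow> nat set set \<Rightarrow> nat set set \<Rightarrow> nat" where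
  "dim_im_psi k i K L =
    vectorspace.dim (class_ring :: 'k ring)
      ((rel_homology i K L :: ('k, 'k chain set) module)
        \<lparr>carrier := psi i K L ` carrier (reduced_homology i K :: ('k, 'k chain set) module)\<rparr>)"

definition boundary_faces :: "'k::field itself \<Rightarrow> nat \<Rightarrow> nat set set \<Rightarrow> nat set set" where
  "boundary_faces k d K =
    {F \<in> K. F \<noteq> {} \<and>
      zero_space (reduced_homology (int d - int (card F) - 1) (link K F)
        :: ('k, 'k chain set) module)}"

text \<open>If there are no boundary faces this is \<open>{{}}\<close>, so that the homology of the pair is then the
  unreduced homology of \<open>K\<close>.\<close>

definition boundary_complex :: "'k::field itself \<Rightarrow> nat \<Rightarrow> nat set set \<Rightarrow> nat set set" where
  "boundary_complex k d K = insert {} (boundary_faces k d K)"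

definition homology_manifold_links :: "'k::field itself \<Rightarrow> nat \<Rightarrow> nat set set \<Rightarrow> bool" where
  "homology_manifold_links k d K \<longleftrightarrow>
    simplicial_complex_on (\<Union>K) K \<and> pure_complex d K \<and>
    (\<forall>F\<in>K. F \<noteq> {} \<longrightarrow>
      (\<forall>i < int d - int (card F) - 1.
        zero_space (reduced_homology i (link K F) :: ('k, 'k chain set) module)) \<and>
      (let H = reduced_homology (int d - int (card F) - 1) (link K F) :: ('k, 'k chain set) module
       in iso_spaces H field_space \<or> zero_space H))"

text \<open>The second conjunct is the standing assumption that the boundary, if there is one, is itself a
  homology manifold without boundary.\<close>

definition homology_manifold :: "'k::field itself \<Rightarrow> nat \<Rightarrow> nat set set \<Rightarrow> bool" where
  "homology_manifold k d K \<longleftrightarrow>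
    homology_manifold_links k d K \<and>
    (boundary_faces k d K \<noteq> {} \<longrightarrow>
      homology_manifold_links k (d - 1) (boundary_complex k d K) \<and>
      boundary_faces k (d - 1) (boundary_complex k d K) = {})"

text \<open>Orientability over \<open>'k\<close> means Poincare-Lefschetz duality. The absolute homology has to be
  unreduced here: for \<open>i = d\<close>, the relative homology in top degree is dual to the unreduced homology
  in degree 0 (so it is \<open>'k\<close> if the complex is connected).\<close>

definition orientable :: "'k::field itself \<Rightarrow> nat \<Rightarrow> nat set set \<Rightarrow> bool" where
  "orientable k d K \<longleftrightarrow>
    (\<forall>i\<in>{1..d}. iso_spaces
      (rel_homology (int i - 1) K (boundary_complex k d K) :: ('k, 'k chain set) module)
      (unreduced_homology (int d - int i) K :: ('k, 'k chain set) module))"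

definition num_faces :: "int \<Rightarrow> nat set set \<Rightarrow> nat" where
  "num_faces i K = card {F \<in> K. int (card F) = i + 1}"

definition h_number :: "nat \<Rightarrow> nat set set \<Rightarrow> nat \<Rightarrow> int" where
  "h_number D K i =
    coeff (\<Sum>j\<le>D. of_nat (num_faces (int j - 1) K) * [:0, 1:] ^ j * [:1, -1:] ^ (D - j)) i"

definition h'_number :: "'k::field itself \<Rightarrow> nat \<Rightarrow> nat set set \<Rightarrow> nat \<Rightarrow> int" where
  "h'_number k D K i =
    h_number D K i +
    int (D choose i) * (\<Sum>j\<in>{1..<i}. (-1) ^ (i - j - 1) * int (betti k (int j - 1) K))"

text \<open>Here \<open>D\<close> is one more than the dimension of \<open>K\<close>, so \<open>D = d - 1\<close> for the boundary of a manifold of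
  dimension \<open>d - 1\<close>.\<close>

definition g_bar :: "'k::field itself \<Rightarrow> nat \<Rightarrow> nat set set \<Rightarrow> nat \<Rightarrow> int" where
  "g_bar k D K i =
    h'_number k D K i -
    (if i = 0 then 0
     else h'_number k D K (i - 1) - int (D choose (i - 1)) * int (betti k (int i - 2) K))"

end

theory Submission
  imports Defs
begin

text \<open>Write \<open>x\<close> for the variable and \<open>y = 1 - x\<close>, and \<open>d - 1\<close> for the dimension. Expanding
  \<open>x\<^sup>k = (1 - y)\<^sup>k\<close> writes the \<open>h\<close>-polynomial as the sum of \<open>y\<^bsup>d - |F|\<^esup>\<close> over the faces \<open>F\<close>,
  weighted by the Euler characteristics of the links, which the manifold hypothesis prescribes.
  Doing so for the manifold and for its closed boundary yields the Dehn-Sommerville relations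
  \<open>h\<^bsub>d - i\<^esub>(\<Delta>) - h\<^sub>i(\<Delta>) + g\<^sub>i(\<partial>\<Delta>) = \<plusminus> (d choose i) \<chi>(\<Delta>)\<close>. By the Euler-Poincare formula it
  remains to evaluate an alternating sum of Betti numbers; duality turns its upper half into
  relative Betti numbers, to which the long exact sequence of the pair, truncated at \<open>\<psi>\<close>, applies.\<close>

subsection \<open>Vector spaces as module records\<close>

text \<open>The corrections in the statement complete truncated sums. Each \<open>h'_number\<close>
  is an \<open>h_number\<close> minus a binomial multiple of an alternating Betti sum; subtracting
  the Betti number in degree \<open>d - i - 1\<close> lengthens that sum by one term, and the
  correction in \<open>g_bar\<close> makes both boundary sums equally long, so that Pascal's rule
  merges them. What then remains of the Euler characteristic of \<Delta> lies in degrees at least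
  \<open>d - i\<close>, dual to relative homology in degrees below \<open>i\<close>. As
  \<open>i < d\<close>, these absolute degrees are positive, where reduced and unreduced homology
  agree. No connecting homomorphism is constructed. Cycles, boundaries and their relative versions
  are subspaces of one infinite-dimensional \<open>chain_space\<close>, and exactness becomes a
  count of dimensions of sums and intersections; finite dimension is therefore argued for each
  subspace.\<close>

lemma (in vectorspace) subspace_fin_dim:
  assumes "fin_dim" and W: "submodule K W V"
  shows "vectorspace.fin_dim K (vs W)"
proof -
  have "subspace K W V"
    unfolding VectorSpace.subspace_def using W vectorspace_axioms by blast
  then interpret W: vectorspace K "vs W"
    by (rule subspace_is_vs)
  have WV: "W \<subseteq> carrier V"
    using W by (simp add: submodule_def)
  \<comment> \<open>A set independent in \<open>W\<close> is independent in \<open>V\<close>, so its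
    size is at most \<open>dim\<close>; hence a maximal one exists, and it is a basis of
    \<open>W\<close>.\<close>
  have "\<exists>B. finite B \<and> maximal B (\<lambda>S. S \<subseteq> carrier (vs W) \<and> W.module.lin_indpt S)"
  proof (rule maximal_exists)
    fix S
    assume "S \<subseteq> carrier (vs W) \<and> W.module.lin_indpt S"
    then have "S \<subseteq> carrier V" "lin_indpt S"
      using WV span_li_not_depend(2)[OF _ W, of S] by auto
    then show "finite S \<and> card S \<le> dim"
      using li_le_dim[OF \<open>fin_dim\<close>] by blast
  next
    show "{} \<subseteq> carrier (vs W) \<and> W.module.lin_indpt {}"
      by (auto simp: W.module.lin_dep_def)
  qed
  then obtain B where "finite B" and B: "W.basis B"
    using W.max_li_is_basis by blast
  then show ?thesis
    unfolding W.fin_dim_def W.basis_def by blast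
qed

text \<open>The vector space axioms transport along a surjection that respects the operations;
  images and quotients get their structure this way.\<close>

lemma linear_map_onto_image:
  assumes V: "vectorspace K V"
    and add: "\<And>u v. u \<in> carrier V \<Longrightarrow> v \<in> carrier V \<Longrightarrow> f (u \<oplus>\<^bsub>V\<^esub> v) = f u \<oplus>\<^bsub>W\<^esub> f v"
    and smult: "\<And>a v. a \<in> carrier K \<Longrightarrow> v \<in> carrier V \<Longrightarrow> f (a \<odot>\<^bsub>V\<^esub> v) = a \<odot>\<^bsub>W\<^esub> f v"
    and carr: "carrier W = f ` carrier V" and zero: "\<zero>\<^bsub>W\<^esub> = f \<zero>\<^bsub>V\<^esub>"
  shows "linear_map K V W f"
proof -
  interpret V: vectorspace K V by fact
  have "vectorspace K W"
  proof (rule vs_criteria)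
    show "field K" ..
  qed (auto simp: carr zero add[symmetric] smult[symmetric] V.module.M.a_ac
      V.module.smult_assoc1 V.module.smult_l_distr V.module.smult_r_distr
      V.module.M.r_neg intro!: rev_bexI[where x = "\<ominus>\<^bsub>V\<^esub> _"])
  moreover have "mod_hom K V W f"
    using calculation V.module.module_axioms add smult
    by (auto simp: vectorspace_def mod_hom_def mod_hom_axioms_def LinearCombinations.module_hom_def carr)
  ultimately show ?thesis
    using V by (simp add: linear_map_def)
qed

lemma (in linear_map) surj_rank_nullity:
  assumes "V.fin_dim" and "T ` carrier V = carrier W"
  shows "W.dim + vectorspace.dim K (V.vs {v \<in> carrier V. T v = \<zero>\<^bsub>W\<^esub>}) = V.dim"
  using rank_nullity[OF assms(1)] surj_imp_imT_carrier[OF assms(2)] by (simp add: ker_def)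

lemma iso_spaces_dim:
  assumes "iso_spaces V W" "vectorspace class_ring V" "vectorspace class_ring W"
    and "vectorspace.fin_dim class_ring V"
  shows "vectorspace.dim class_ring V = vectorspace.dim class_ring W"
proof -
  obtain f where f: "f \<in> LinearCombinations.module_hom class_ring V W"
    "bij_betw f (carrier V) (carrier W)"
    using assms(1) by (auto simp: iso_spaces_def)
  interpret linear_map class_ring V W f
    using assms(2,3) f(1)
    by (auto simp: linear_map_def vectorspace_def mod_hom_def mod_hom_axioms_def)
  show ?thesis
    using dim_eq[OF assms(4)] f(2) by (simp add: bij_betw_def)
qed

lemma zero_space_dim:
  assumes "vectorspace class_ring V" and "zero_space V"
  shows "vectorspace.dim class_ring V = 0"
proof -
  interpret vectorspace class_ring V by fact
  have "gen_set {\<zero>\<^bsub>V\<^esub>}"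
    using assms(2) span_is_subset2[of "{\<zero>\<^bsub>V\<^esub>}"] span_zero by (auto simp: zero_space_def)
  then show ?thesis
    by (rule dim0I)
qed

lemma vectorspace_field_space: "vectorspace class_ring (field_space :: ('k::field, 'k) module)"
  by (rule vs_criteria)
    (auto simp: field_space_def algebra_simps class_field.field_axioms intro: exI[of _ "- _"])

lemma dim_field_space: "vectorspace.dim class_ring (field_space :: ('k::field, 'k) module) = 1"
proof -
  interpret vectorspace class_ring "field_space :: ('k, 'k) module"
    by (rule vectorspace_field_space)
  have [simp]: "carrier (field_space :: ('k, 'k) module) = UNIV"
    "smult (field_space :: ('k, 'k) module) = (*)"
    by (simp_all add: field_space_def)
  have "x \<in> span {1}" for x :: 'k
  proof -
    have "lincomb (\<lambda>_. x) {1} = x"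
      by (simp add: lincomb_def)
    then show ?thesis
      by (auto simp: span_def intro!: exI[of _ "\<lambda>_. x"] exI[of _ "{1}"])
  qed
  then have "gen_set {1}"
    by (auto simp: field_space_def)
  then show ?thesis
    by (rule dim1I) (auto simp: field_space_def)
qed

subsection \<open>Subspaces of the chain space\<close>

lemma chain_space_simps [simp]:
  "carrier chain_space = UNIV" "\<zero>\<^bsub>chain_space\<^esub> = (\<lambda>F. 0)"
  "x \<oplus>\<^bsub>chain_space\<^esub> y = (\<lambda>F. x F + y F)" "a \<odot>\<^bsub>chain_space\<^esub> x = (\<lambda>F. a * x F)"
  by (simp_all add: chain_space_def)

lemma vectorspace_chain_space: "vectorspace class_ring (chain_space :: ('k::field, 'k chain) module)"
proof (rule vs_criteria)
  have "\<exists>w. (\<lambda>F. v F + w F) = (\<lambda>F. 0)" for v :: "'k chain"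
    by (rule exI[of _ "\<lambda>F. - v F"]) simp
  then show "\<forall>v\<in>carrier chain_space. \<exists>w\<in>carrier chain_space.
      v \<oplus>\<^bsub>chain_space\<^esub> w = (\<zero>\<^bsub>chain_space\<^esub> :: 'k chain)"
    by simp
qed (simp_all add: algebra_simps class_field.field_axioms)

abbreviation subchain_space :: "'k::field chain set \<Rightarrow> ('k, 'k chain) module" where
  "subchain_space S \<equiv> chain_space\<lparr>carrier := S\<rparr>"

text \<open>A subspace is kept as a bare set of chains, so that cycles, boundaries and chains of a
  subcomplex can be intersected and compared before any module record is formed.\<close>

definition lin_closed :: "'k::field chain set \<Rightarrow> bool" where
  "lin_closed S \<longleftrightarrow> (\<lambda>F. 0) \<in> S \<and> (\<forall>x\<in>S. \<forall>y\<in>S. (\<lambda>F. x F + y F) \<in> S) \<and>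
    (\<forall>a. \<forall>x\<in>S. (\<lambda>F. a * x F) \<in> S)"

lemma lin_closed_submodule: "lin_closed S \<Longrightarrow> submodule class_ring S chain_space"
  using vectorspace_chain_space by (auto simp: lin_closed_def submodule_def vectorspace_def)

lemma lin_closed_vectorspace:
  assumes "lin_closed S"
  shows "vectorspace class_ring (subchain_space S)"
proof -
  interpret vectorspace class_ring chain_space by (rule vectorspace_chain_space)
  show ?thesis
    using submodule_is_module[OF lin_closed_submodule[OF assms]]
    by (simp add: vectorspace_def class_field.field_axioms)
qed

lemma lin_closed_Int: "lin_closed S \<Longrightarrow> lin_closed T \<Longrightarrow> lin_closed (S \<inter> T)"
  by (auto simp: lin_closed_def)

lemma lin_closed_zero: "lin_closed S \<Longrightarrow> (\<lambda>F. 0) \<in> S"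
  and lin_closed_add: "lin_closed S \<Longrightarrow> x \<in> S \<Longrightarrow> y \<in> S \<Longrightarrow> (\<lambda>F. x F + y F) \<in> S"
  and lin_closed_smult: "lin_closed S \<Longrightarrow> x \<in> S \<Longrightarrow> (\<lambda>F. a * x F) \<in> S"
  by (simp_all add: lin_closed_def)

lemma lin_closedI:
  assumes "(\<lambda>F. 0) \<in> S" "\<And>x y. x \<in> S \<Longrightarrow> y \<in> S \<Longrightarrow> (\<lambda>F. x F + y F) \<in> S"
    "\<And>a x. x \<in> S \<Longrightarrow> (\<lambda>F. a * x F) \<in> S"
  shows "lin_closed S"
  using assms by (simp add: lin_closed_def)

lemma lin_closed_diff:
  assumes "lin_closed S" "x \<in> S" "y \<in> S"
  shows "(\<lambda>F. x F - y F) \<in> S"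
  using lin_closed_add[OF assms(1,2) lin_closed_smult[OF assms(1,3), of "-1"]] by simp

definition fin_subspace :: "'k::field chain set \<Rightarrow> bool" where
  "fin_subspace S \<longleftrightarrow> lin_closed S \<and> vectorspace.fin_dim class_ring (subchain_space S)"

definition sdim :: "'k::field chain set \<Rightarrow> nat" where
  "sdim S = vectorspace.dim class_ring (subchain_space S)"

lemma fin_subspace_subset:
  assumes "fin_subspace T" "lin_closed S" "S \<subseteq> T"
  shows "fin_subspace S"
proof -
  interpret T: vectorspace class_ring "subchain_space T"
    using assms(1) by (intro lin_closed_vectorspace) (simp add: fin_subspace_def)
  have "submodule class_ring S (subchain_space T)"
    using assms(2,3) T.module.module_axioms by (auto simp: submodule_def lin_closed_def)
  from T.subspace_fin_dim[OF _ this] show ?thesis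
    using assms(1,2) by (simp add: fin_subspace_def)
qed

definition supported_on :: "nat set set \<Rightarrow> 'k::field chain set" where
  "supported_on A = {c. \<forall>F. c F \<noteq> 0 \<longrightarrow> F \<in> A}"

lemma lin_closed_supported_on: "lin_closed (supported_on A)"
proof -
  have "F \<in> A" if "x \<in> supported_on A" "y \<in> supported_on A" "x F + y F \<noteq> 0"
    for x y :: "'k::field chain" and F
    using that by (cases "x F = 0") (auto simp: supported_on_def)
  then show ?thesis
    by (intro lin_closedI) (auto simp: supported_on_def)
qed

lemma finsum_chain:
  assumes "lin_closed S" "finite B" "\<And>b. b \<in> B \<Longrightarrow> f b \<in> S"
  shows "finsum (subchain_space S) f B = (\<lambda>F. \<Sum>b\<in>B. f b F)"
proof -
  interpret vectorspace class_ring "subchain_space S"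
    by (rule lin_closed_vectorspace) fact
  show ?thesis
    using assms(2,3) by (induction B rule: finite_induct) (auto simp: Pi_def)
qed

lemma supported_on_dim:
  assumes "finite A"
  shows "fin_subspace (supported_on A :: 'k::field chain set)"
    and "sdim (supported_on A :: 'k chain set) = card A"
proof -
  let ?S = "supported_on A :: 'k chain set"
  interpret vectorspace class_ring "subchain_space ?S"
    by (rule lin_closed_vectorspace[OF lin_closed_supported_on])
  define e :: "nat set \<Rightarrow> 'k chain" where "e F = (\<lambda>G. if G = F then 1 else 0)" for F
  have e_inj: "inj_on e A"
    by (auto simp: inj_on_def e_def fun_eq_iff split: if_splits)
  have eS: "e ` A \<subseteq> ?S"
    by (auto simp: e_def supported_on_def split: if_splits)
  have smS: "(\<lambda>F. a * x F) \<in> ?S" if "x \<in> ?S" for a x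
    using that by (auto simp: supported_on_def)
  have lc: "lincomb a (e ` A) = (\<lambda>G. if G \<in> A then a (e G) else 0)" for a
  proof -
    have "lincomb a (e ` A) = (\<lambda>G. \<Sum>b\<in>e ` A. a b * b G)"
      unfolding lincomb_def using assms eS smS
      by (subst finsum_chain[OF lin_closed_supported_on]) auto
    also have "\<dots> = (\<lambda>G. \<Sum>F\<in>A. a (e F) * e F G)"
      by (simp add: sum.reindex[OF e_inj])
    also have "\<dots> = (\<lambda>G. if G \<in> A then a (e G) else 0)"
      using assms by (auto simp: e_def fun_eq_iff if_distrib sum.delta' cong: if_cong)
    finally show ?thesis .
  qed
  have "basis (e ` A)"
  proof (subst basis_criterion)
    show "\<forall>c. c \<in> carrier (subchain_space ?S) \<longrightarrow>
      (\<exists>!a. a \<in> e ` A \<rightarrow>\<^sub>E carrier class_ring \<and> lincomb a (e ` A) = c)"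
    proof (intro allI impI ex1I conjI)
      fix c assume c: "c \<in> carrier (subchain_space ?S)"
      \<comment> \<open>Coefficients are indexed by basis vectors, not by faces, so the value of
        \<open>c\<close> at a face is reached through the inverse of \<open>e\<close>.\<close>
      let ?a = "restrict (\<lambda>b. c (inv_into A e b)) (e ` A)"
      show "?a \<in> e ` A \<rightarrow>\<^sub>E carrier class_ring" by simp
      show "lincomb ?a (e ` A) = c"
        unfolding lc using c by (auto simp: fun_eq_iff supported_on_def inv_into_f_f[OF e_inj])
      fix a assume a: "a \<in> e ` A \<rightarrow>\<^sub>E carrier class_ring \<and> lincomb a (e ` A) = c"
      then have "a (e G) = c G" if "G \<in> A" for G
        using that by (auto simp: lc)
      then show "a = ?a"
        using a by (intro extensionalityI[of _ "e ` A"])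
          (auto simp: PiE_def inv_into_f_f[OF e_inj])
    qed
  qed (use assms eS in auto)
  moreover have "finite (e ` A)" "card (e ` A) = card A"
    using assms by (auto simp: card_image e_inj)
  ultimately show "fin_subspace ?S" "sdim ?S = card A"
    using dim_basis[of "e ` A"] lin_closed_supported_on
    by (auto simp: fin_subspace_def sdim_def fin_dim_def basis_def)
qed

lemma linear_map_chain_image:
  assumes "lin_closed S"
    and "\<And>x y. x \<in> S \<Longrightarrow> y \<in> S \<Longrightarrow> f (\<lambda>F. x F + y F) = f x \<oplus>\<^bsub>W\<^esub> f y"
    and "\<And>a x. x \<in> S \<Longrightarrow> f (\<lambda>F. a * x F) = a \<odot>\<^bsub>W\<^esub> f x"
    and "\<zero>\<^bsub>W\<^esub> = f (\<lambda>F. 0)"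
  shows "linear_map class_ring (subchain_space S) (W\<lparr>carrier := f ` S\<rparr>) f"
  by (rule linear_map_onto_image) (use assms lin_closed_vectorspace in auto)

text \<open>Linearity is asked for on \<open>S\<close> alone because \<open>chain_boundary\<close>
  is not linear on all of \<open>chain_space\<close>: its sum over an infinite support is 0 by
  convention.\<close>

lemma chain_map_rank_nullity:
  fixes f :: "'k::field chain \<Rightarrow> 'k chain"
  assumes S: "fin_subspace S"
    and add: "\<And>x y. x \<in> S \<Longrightarrow> y \<in> S \<Longrightarrow> f (\<lambda>F. x F + y F) = (\<lambda>F. f x F + f y F)"
    and smult: "\<And>a x. x \<in> S \<Longrightarrow> f (\<lambda>F. a * x F) = (\<lambda>F. a * f x F)"
  shows "sdim (f ` S) + sdim {x \<in> S. f x = (\<lambda>F. 0)} = sdim S"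
    and "lin_closed (f ` S)" "lin_closed {x \<in> S. f x = (\<lambda>F. 0)}"
proof -
  have lc: "lin_closed S" using S by (simp add: fin_subspace_def)
  then have "(\<lambda>F. 0) \<in> S" by (simp add: lin_closed_def)
  from smult[OF this, of 0] have 0: "f (\<lambda>F. 0) = (\<lambda>F. 0)" by simp
  interpret linear_map class_ring "subchain_space S" "subchain_space (f ` S)" f
    by (rule linear_map_chain_image) (use lc add smult 0 in auto)
  show "sdim (f ` S) + sdim {x \<in> S. f x = (\<lambda>F. 0)} = sdim S"
    using surj_rank_nullity S by (simp add: sdim_def fin_subspace_def)
  show "lin_closed (f ` S)"
  proof (rule lin_closedI)
    show "(\<lambda>F. 0) \<in> f ` S"
      using lin_closed_zero[OF lc] 0 by force
  next
    fix u v assume "u \<in> f ` S" "v \<in> f ` S"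
    then obtain x y where "x \<in> S" "y \<in> S" "u = f x" "v = f y" by blast
    then show "(\<lambda>F. u F + v F) \<in> f ` S"
      using add[of x y] lin_closed_add[OF lc, of x y] by (simp add: rev_image_eqI)
  next
    fix a u assume "u \<in> f ` S"
    then obtain x where "x \<in> S" "u = f x" by blast
    then show "(\<lambda>F. a * u F) \<in> f ` S"
      using smult[of x a] lin_closed_smult[OF lc, of x a] by (simp add: rev_image_eqI)
  qed
  show "lin_closed {x \<in> S. f x = (\<lambda>F. 0)}"
    using lc by (intro lin_closedI) (simp_all add: 0 add smult lin_closed_zero lin_closed_add lin_closed_smult)
qed

section \<open>Quotients of subspaces of the chain space\<close>

definition coset :: "'k::field chain set \<Rightarrow> 'k chain \<Rightarrow> 'k chain set" where
  "coset B c = B +>\<^bsub>chain_space\<^esub> c"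

text \<open>The image of \<open>S\<close> in \<open>chain_space\<close> modulo \<open>B\<close>.
  Since \<open>B\<close> may stick out of \<open>S\<close>, this is S/(S \<inter> B) up to
  isomorphism; the homology of a pair and the image of \<open>psi\<close> are both of this
  form.\<close>

definition quotient_subspace :: "'k::field chain set \<Rightarrow> 'k chain set \<Rightarrow> ('k, 'k chain set) module" where
  "quotient_subspace S B = (quotient_space chain_space B)\<lparr>carrier := coset B ` S\<rparr>"

lemma mem_coset:
  assumes "lin_closed B"
  shows "x \<in> coset B c \<longleftrightarrow> (\<lambda>F. x F - c F) \<in> B"
proof
  assume "x \<in> coset B c"
  then show "(\<lambda>F. x F - c F) \<in> B"
    by (auto simp: coset_def a_r_coset_def')
next
  assume "(\<lambda>F. x F - c F) \<in> B"
  then show "x \<in> coset B c"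
    unfolding coset_def a_r_coset_def' by (rule UN_I) simp
qed

lemma coset_self: "lin_closed B \<Longrightarrow> x \<in> coset B x"
  by (simp add: mem_coset lin_closed_zero)

lemma coset_eq_iff:
  assumes "lin_closed B"
  shows "coset B x = coset B y \<longleftrightarrow> (\<lambda>F. x F - y F) \<in> B"
proof
  assume "coset B x = coset B y"
  then show "(\<lambda>F. x F - y F) \<in> B"
    using coset_self[OF assms, of x] assms by (simp add: mem_coset)
next
  assume xy: "(\<lambda>F. x F - y F) \<in> B"
  have "(\<lambda>F. z F - x F) \<in> B \<longleftrightarrow> (\<lambda>F. z F - y F) \<in> B" for z
    using lin_closed_add[OF assms xy, of "\<lambda>F. z F - x F"]
      lin_closed_diff[OF assms _ xy, of "\<lambda>F. z F - y F"] by auto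
  then show "coset B x = coset B y"
    by (auto simp: mem_coset[OF assms])
qed

lemma coset_zero: "lin_closed B \<Longrightarrow> coset B (\<lambda>F. 0) = B"
  by (auto simp: mem_coset)

text \<open>Scalar multiplication in \<open>quotient_space\<close> and the map \<open>psi\<close>
  are unions over all representatives. Independence of the representative makes such a union a
  single coset.\<close>

lemma Union_coset:
  assumes "lin_closed B" "X \<noteq> {}" "\<And>x. x \<in> X \<Longrightarrow> (\<lambda>F. g x F - c F) \<in> B"
  shows "(\<Union>x\<in>X. coset B (g x)) = coset B c"
proof -
  have "coset B (g x) = coset B c" if "x \<in> X" for x
    using coset_eq_iff[OF assms(1)] assms(3)[OF that] by simp
  with assms(2) show ?thesis by simp
qed

lemma coset_add:
  assumes "lin_closed B"
  shows "coset B x <+>\<^bsub>chain_space\<^esub> coset B y = coset B (\<lambda>F. x F + y F)"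
proof (intro equalityI subsetI)
  fix z assume "z \<in> coset B x <+>\<^bsub>chain_space\<^esub> coset B y"
  then obtain u v where "u \<in> coset B x" "v \<in> coset B y" "z = (\<lambda>F. u F + v F)"
    by (auto simp: set_add_def')
  then show "z \<in> coset B (\<lambda>F. x F + y F)"
    using lin_closed_add[OF assms, of "\<lambda>F. u F - x F" "\<lambda>F. v F - y F"]
    by (simp add: mem_coset[OF assms] algebra_simps)
next
  fix z assume "z \<in> coset B (\<lambda>F. x F + y F)"
  then have "(\<lambda>F. z F - y F) \<in> coset B x"
    by (simp add: mem_coset[OF assms] algebra_simps)
  then show "z \<in> coset B x <+>\<^bsub>chain_space\<^esub> coset B y"
    using coset_self[OF assms, of y] unfolding set_add_def'
    by (intro UN_I[where a = "\<lambda>F. z F - y F"] UN_I[where a = y and A = "coset B y"]) simp_all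
qed

lemma quotient_subspace_map:
  fixes S B :: "'k::field chain set"
  assumes "lin_closed S" "lin_closed B"
  shows "linear_map class_ring (subchain_space S) (quotient_subspace S B) (coset B)"
  unfolding quotient_subspace_def
proof (rule linear_map_chain_image)
  fix x y :: "'k chain" and a
  show "coset B (\<lambda>F. x F + y F) = coset B x \<oplus>\<^bsub>quotient_space chain_space B\<^esub> coset B y"
    by (simp add: quotient_space_def coset_add[OF assms(2)])
  have "(\<Union>z\<in>coset B x. coset B (\<lambda>F. a * z F)) = coset B (\<lambda>F. a * x F)"
  proof (rule Union_coset[OF assms(2)])
    fix z assume "z \<in> coset B x"
    then show "(\<lambda>F. a * z F - a * x F) \<in> B"
      using lin_closed_smult[OF assms(2), of "\<lambda>F. z F - x F" a]
      by (simp add: mem_coset[OF assms(2)] algebra_simps)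
  qed (use coset_self[OF assms(2)] in auto)
  then show "coset B (\<lambda>F. a * x F) = a \<odot>\<^bsub>quotient_space chain_space B\<^esub> coset B x"
    by (simp add: quotient_space_def coset_def)
next
  show "\<zero>\<^bsub>quotient_space chain_space B\<^esub> = coset B (\<lambda>F. 0)"
    by (auto simp: quotient_space_def mem_coset[OF assms(2)])
qed fact

text \<open>Rank-nullity for the surjection \<open>coset B\<close>, whose kernel on \<open>S\<close>
  is \<open>S \<inter> B\<close>.\<close>

lemma quotient_subspace_dim:
  assumes "fin_subspace S" "lin_closed B"
  shows "vectorspace.dim class_ring (quotient_subspace S B) + sdim (S \<inter> B) = sdim S"
    and "vectorspace class_ring (quotient_subspace S B)"
    and "vectorspace.fin_dim class_ring (quotient_subspace S B)"
proof -
  interpret linear_map class_ring "subchain_space S" "quotient_subspace S B" "coset B"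
    using assms by (intro quotient_subspace_map) (auto simp: fin_subspace_def)
  have "{v \<in> S. coset B v = \<zero>\<^bsub>quotient_subspace S B\<^esub>} = S \<inter> B"
    using coset_eq_iff[OF assms(2), of _ "\<lambda>F. 0"]
    by (auto simp: quotient_subspace_def quotient_space_def coset_zero[OF assms(2)])
  moreover have surj: "coset B ` carrier (subchain_space S) = carrier (quotient_subspace S B)"
    by (simp add: quotient_subspace_def)
  moreover have fd: "V.fin_dim"
    using assms(1) by (simp add: fin_subspace_def)
  ultimately show "W.dim + sdim (S \<inter> B) = sdim S"
    using surj_rank_nullity[OF fd surj] by (simp add: sdim_def)
  show "vectorspace class_ring (quotient_subspace S B)" ..
  show "W.fin_dim" using fd surj by (rule surj_fin_dim)
qed

definition subspace_plus :: "'k::field chain set \<Rightarrow> 'k chain set \<Rightarrow> 'k chain set" where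
  "subspace_plus S T = {\<lambda>F. x F + y F |x y. x \<in> S \<and> y \<in> T}"

lemma subspace_plusI:
  "x \<in> S \<Longrightarrow> y \<in> T \<Longrightarrow> (\<And>F. u F = x F + y F) \<Longrightarrow> u \<in> subspace_plus S T"
  unfolding subspace_plus_def by (intro CollectI exI[of _ x] exI[of _ y]) auto

lemma subspace_plusE:
  assumes "u \<in> subspace_plus S T"
  obtains x y where "x \<in> S" "y \<in> T" "u = (\<lambda>F. x F + y F)"
  using assms by (auto simp: subspace_plus_def)

lemma lin_closed_plus:
  assumes "lin_closed S" "lin_closed T"
  shows "lin_closed (subspace_plus S T)"
proof (rule lin_closedI)
  show "(\<lambda>F. 0) \<in> subspace_plus S T"
    by (rule subspace_plusI[OF lin_closed_zero lin_closed_zero]) (simp_all add: assms)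
next
  fix u v assume "u \<in> subspace_plus S T" "v \<in> subspace_plus S T"
  then obtain x y x' y' where *: "u = (\<lambda>F. x F + y F)" "v = (\<lambda>F. x' F + y' F)"
    "x \<in> S" "x' \<in> S" "y \<in> T" "y' \<in> T"
    by (auto elim!: subspace_plusE)
  show "(\<lambda>F. u F + v F) \<in> subspace_plus S T"
    by (rule subspace_plusI[OF lin_closed_add[OF assms(1) *(3,4)] lin_closed_add[OF assms(2) *(5,6)]])
      (simp add: *(1,2) algebra_simps)
next
  fix a u assume "u \<in> subspace_plus S T"
  then obtain x y where *: "u = (\<lambda>F. x F + y F)" "x \<in> S" "y \<in> T"
    by (auto elim!: subspace_plusE)
  show "(\<lambda>F. a * u F) \<in> subspace_plus S T"
    by (rule subspace_plusI[OF lin_closed_smult[OF assms(1) *(2), of a]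
          lin_closed_smult[OF assms(2) *(3), of a]])
      (simp add: *(1) algebra_simps)
qed

lemma subspace_plus_upper:
  assumes "lin_closed S" "lin_closed T"
  shows "S \<subseteq> subspace_plus S T" "T \<subseteq> subspace_plus S T"
proof -
  show "S \<subseteq> subspace_plus S T"
    using subspace_plusI[OF _ lin_closed_zero[OF assms(2)]] by auto
  show "T \<subseteq> subspace_plus S T"
    using subspace_plusI[OF lin_closed_zero[OF assms(1)]] by auto
qed

text \<open>Both sides count the dimension of \<open>(S + T)/T = S/(S \<inter> T)\<close>.\<close>

lemma sdim_plus:
  assumes "fin_subspace U" "lin_closed S" "lin_closed T" "S \<subseteq> U" "T \<subseteq> U"
  shows "sdim (subspace_plus S T) + sdim (S \<inter> T) = sdim S + sdim T"
proof -
  let ?P = "subspace_plus S T"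
  have "?P \<subseteq> U"
    using assms by (auto simp: fin_subspace_def intro: lin_closed_add elim!: subspace_plusE)
  then have fin: "fin_subspace ?P" "fin_subspace S"
    using fin_subspace_subset[OF assms(1)] lin_closed_plus assms by auto
  have "coset T ` ?P = coset T ` S"
  proof
    show "coset T ` S \<subseteq> coset T ` ?P"
      using subspace_plus_upper(1)[OF assms(2,3)] by auto
    show "coset T ` ?P \<subseteq> coset T ` S"
    proof
      fix X assume "X \<in> coset T ` ?P"
      then obtain x y where "x \<in> S" "y \<in> T" "X = coset T (\<lambda>F. x F + y F)"
        by (auto simp: subspace_plus_def)
      then show "X \<in> coset T ` S"
        using coset_eq_iff[OF assms(3), of "\<lambda>F. x F + y F" x] by auto
    qed
  qed
  then have "quotient_subspace ?P T = quotient_subspace S T"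
    by (simp add: quotient_subspace_def)
  moreover have "?P \<inter> T = T"
    using subspace_plus_upper(2)[OF assms(2,3)] by auto
  ultimately show ?thesis
    using quotient_subspace_dim(1)[OF fin(1) assms(3)] quotient_subspace_dim(1)[OF fin(2) assms(3)]
    by simp
qed

subsection \<open>The chain complex\<close>

text \<open>This admits the void complex, which is what \<open>link K F\<close> is when
  \<open>F\<close> is not a face.\<close>

definition face_complex :: "nat set set \<Rightarrow> bool" where
  "face_complex K \<longleftrightarrow> finite (\<Union>K) \<and> (\<forall>F\<in>K. \<forall>G. G \<subseteq> F \<longrightarrow> G \<in> K)"

lemma face_complex_finite: "face_complex K \<Longrightarrow> finite K"
  unfolding face_complex_def by (meson finite_UnionD)

lemma face_complex_finite_face: "face_complex K \<Longrightarrow> F \<in> K \<Longrightarrow> finite F"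
  unfolding face_complex_def by (meson Sup_upper finite_subset)

text \<open>For \<open>v\<close> outside \<open>G\<close>, the sign with which \<open>G\<close>
  occurs in the boundary of \<open>insert v G\<close>.\<close>

definition incidence :: "nat set \<Rightarrow> nat \<Rightarrow> 'k::field" where
  "incidence G v = (-1) ^ card {u \<in> G. u < v}"

lemma incidence_insert:
  assumes "v \<noteq> w" "v \<notin> G"
  shows "incidence (insert v G) w = (if v < w then - incidence G w else incidence G w)"
proof -
  have "{u \<in> insert v G. u < w} = (if v < w then insert v {u \<in> G. u < w} else {u \<in> G. u < w})"
    by auto
  then show ?thesis
    using assms(2) by (simp add: incidence_def)
qed

text \<open>Summing over the vertices that extend \<open>G\<close>, instead of over the support of
  \<open>c\<close>, makes the index set independent of \<open>c\<close>; linearity and the vanishing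
  of the double boundary are read off from this form.\<close>

lemma chain_boundary_eq:
  assumes V: "finite V" and c: "c \<in> supported_on (Pow V)"
  shows "chain_boundary c G = (\<Sum>v\<in>V. if v \<in> G then 0 else incidence G v * c (insert v G))"
proof -
  have sub: "{F. c F \<noteq> 0} \<subseteq> Pow V"
    using c by (auto simp: supported_on_def)
  have "chain_boundary c G =
      (\<Sum>F\<in>Pow V. \<Sum>v\<in>F. if F - {v} = G then (-1) ^ card {u \<in> F. u < v} * c F else 0)"
    unfolding chain_boundary_def using sub V
    by (intro sum.mono_neutral_left) (auto intro!: sum.neutral)
  also have "\<dots> = (\<Sum>F\<in>Pow V. \<Sum>v\<in>V.
      if F = insert v G \<and> v \<notin> G then incidence G v * c (insert v G) else 0)"
  proof (rule sum.cong[OF refl])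
    fix F assume F: "F \<in> Pow V"
    show "(\<Sum>v\<in>F. if F - {v} = G then (-1) ^ card {u \<in> F. u < v} * c F else 0) =
        (\<Sum>v\<in>V. if F = insert v G \<and> v \<notin> G then incidence G v * c (insert v G) else 0)"
    proof (rule sum.mono_neutral_cong_left)
      fix v assume "v \<in> F"
      then have *: "F - {v} = G \<longleftrightarrow> F = insert v G \<and> v \<notin> G" by auto
      have "{u \<in> insert v G. u < v} = {u \<in> G. u < v}" by auto
      then show "(if F - {v} = G then (-1) ^ card {u \<in> F. u < v} * c F else 0) =
          (if F = insert v G \<and> v \<notin> G then incidence G v * c (insert v G) else 0)"
        unfolding * by (auto simp: incidence_def)
    qed (use V F in auto)
  qed
  also have "\<dots> = (\<Sum>v\<in>V. \<Sum>F\<in>Pow V.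
      if F = insert v G \<and> v \<notin> G then incidence G v * c (insert v G) else 0)"
    by (rule sum.swap)
  also have "\<dots> = (\<Sum>v\<in>V. if v \<in> G then 0 else incidence G v * c (insert v G))"
  proof (intro sum.cong refl)
    fix v assume "v \<in> V"
    show "(\<Sum>F\<in>Pow V. if F = insert v G \<and> v \<notin> G then incidence G v * c (insert v G) else 0) =
        (if v \<in> G then 0 else incidence G v * c (insert v G))"
      using V sub by (cases "v \<in> G") (auto simp: sum.delta)
  qed
  finally show ?thesis .
qed

lemma chain_boundary_nonzeroE:
  assumes "finite V" "c \<in> supported_on (Pow V)" "chain_boundary c G \<noteq> 0"
  obtains v where "v \<notin> G" "c (insert v G) \<noteq> 0"
proof -
  have "\<exists>v. v \<notin> G \<and> c (insert v G) \<noteq> 0"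
  proof (rule ccontr)
    assume "\<not> ?thesis"
    then have "chain_boundary c G = 0"
      unfolding chain_boundary_eq[OF assms(1,2)] by (intro sum.neutral) auto
    with assms(3) show False by simp
  qed
  then show thesis using that by blast
qed

lemma chain_boundary_supported:
  assumes "finite V" "c \<in> supported_on (Pow V)"
  shows "chain_boundary c \<in> supported_on (Pow V)"
proof -
  have "G \<in> Pow V" if "chain_boundary c G \<noteq> 0" for G
    using assms(2) by (rule_tac chain_boundary_nonzeroE[OF assms that]) (auto simp: supported_on_def)
  then show ?thesis by (simp add: supported_on_def)
qed

text \<open>The terms cancel in pairs. The diagonal is treated separately because in characteristic
  two antisymmetry says nothing about it.\<close>

lemma sum_antisymmetric:
  fixes t :: "'a \<Rightarrow> 'a \<Rightarrow> 'b::ab_group_add"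
  assumes "finite V" "\<And>v. t v v = 0" "\<And>v w. t v w + t w v = 0"
  shows "(\<Sum>v\<in>V. \<Sum>w\<in>V. t v w) = 0"
  using assms(1)
proof (induction V rule: finite_induct)
  case (insert x V)
  have "(\<Sum>v\<in>V. t v x) + (\<Sum>w\<in>V. t x w) = 0"
    by (simp add: sum.distrib[symmetric] assms(3))
  then show ?case
    using insert by (simp add: sum.distrib assms(2) add.assoc[symmetric])
qed simp

lemma chain_boundary_boundary:
  assumes V: "finite V" and c: "c \<in> supported_on (Pow V)"
  shows "chain_boundary (chain_boundary c) = (\<lambda>G. 0)"
proof
  fix G
  \<comment> \<open>Adding \<open>v\<close> and \<open>w\<close> to \<open>G\<close> in either order
    reaches the same face with opposite signs, since only the smaller vertex shifts the position of
    the larger one.\<close>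
  let ?t = "\<lambda>v w. if v \<in> G \<or> w \<in> G \<or> v = w then 0
    else incidence G v * incidence (insert v G) w * c (insert v (insert w G))"
  have "chain_boundary (chain_boundary c) G = (\<Sum>v\<in>V. \<Sum>w\<in>V. ?t v w)"
    unfolding chain_boundary_eq[OF V chain_boundary_supported[OF V c]]
    by (auto intro!: sum.cong simp: chain_boundary_eq[OF V c] sum_distrib_left insert_commute mult.assoc)
  also have "\<dots> = 0"
  proof (rule sum_antisymmetric[OF V])
    show "?t v w + ?t w v = 0" for v w
      by (cases "v < w") (auto simp: incidence_insert insert_commute)
  qed simp
  finally show "chain_boundary (chain_boundary c) G = 0" .
qed

lemma chains_eq: "chains i K = supported_on {F \<in> K. int (card F) = i + 1}"
  by (auto simp: chains_def supported_on_def)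

lemma chains_mono: "L \<subseteq> K \<Longrightarrow> chains i L \<subseteq> chains i K"
  by (auto simp: chains_def)

lemma lin_closed_chains: "lin_closed (chains i K)"
  by (simp add: chains_eq lin_closed_supported_on)

lemma chains_dim:
  assumes "face_complex K"
  shows "fin_subspace (chains i K :: 'k::field chain set)"
    and "sdim (chains i K :: 'k chain set) = num_faces i K"
  using supported_on_dim[where 'k = 'k, of "{F \<in> K. int (card F) = i + 1}"] face_complex_finite[OF assms]
  by (simp_all add: chains_eq num_faces_def)

lemma chains_supported: "c \<in> chains i K \<Longrightarrow> c \<in> supported_on (Pow (\<Union>K))"
  by (auto simp: chains_def supported_on_def)

lemma chain_boundary_chains:
  assumes K: "face_complex K" and c: "c \<in> chains i K"
  shows "chain_boundary c \<in> chains (i - 1) K"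
proof -
  have V: "finite (\<Union>K)" using K by (simp add: face_complex_def)
  have "G \<in> K \<and> int (card G) = i" if nz: "chain_boundary c G \<noteq> 0" for G
  proof -
    obtain v where "c (insert v G) \<noteq> 0" "v \<notin> G"
      using chain_boundary_nonzeroE[OF V chains_supported[OF c] nz] by blast
    then have *: "insert v G \<in> K" "int (card (insert v G)) = i + 1" "v \<notin> G"
      using c by (auto simp: chains_def)
    have "G \<in> K"
      using K *(1) unfolding face_complex_def by (meson subset_insertI)
    then show ?thesis
      using *(2,3) face_complex_finite_face[OF K] by simp
  qed
  then show ?thesis unfolding chains_def by simp
qed

lemma chain_boundary_add:
  assumes K: "face_complex K" and "x \<in> chains i K" "y \<in> chains i K"
  shows "chain_boundary (\<lambda>F. x F + y F) = (\<lambda>F. chain_boundary x F + chain_boundary y F)"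
proof -
  have "finite (\<Union>K)" using K by (simp add: face_complex_def)
  note eq = chain_boundary_eq[OF this chains_supported]
  note eqs = eq[OF assms(2)] eq[OF assms(3)] eq[OF lin_closed_add[OF lin_closed_chains assms(2,3)]]
  show ?thesis
    unfolding eqs[abs_def] sum.distrib[symmetric]
    by (intro ext sum.cong refl) (simp add: distrib_left)
qed

lemma chain_boundary_smult:
  assumes K: "face_complex K" and "x \<in> chains i K"
  shows "chain_boundary (\<lambda>F. a * x F) = (\<lambda>F. a * chain_boundary x F)"
proof -
  have "finite (\<Union>K)" using K by (simp add: face_complex_def)
  note eq = chain_boundary_eq[OF this chains_supported]
  note eqs = eq[OF assms(2)] eq[OF lin_closed_smult[OF lin_closed_chains assms(2)]]
  show ?thesis
    unfolding eqs[abs_def] sum_distrib_left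
    by (intro ext sum.cong refl) (simp add: mult.left_commute)
qed

lemma chain_boundary_chains_twice:
  assumes K: "face_complex K" and c: "c \<in> chains i K"
  shows "chain_boundary (chain_boundary c) = (\<lambda>G. 0)"
  using K chains_supported[OF c] by (intro chain_boundary_boundary) (auto simp: face_complex_def)

abbreviation "boundaries i K \<equiv> chain_boundary ` chains (i + 1) K"
abbreviation "cycles i K \<equiv> relcycles i K {}"

lemma chains_empty: "chains i {} = {\<lambda>F. 0}"
  by (auto simp: chains_def)

lemma cycles_eq: "cycles i K = {c \<in> chains i K. chain_boundary c = (\<lambda>F. 0)}"
  by (simp add: relcycles_def chains_empty)

lemma relboundaries_eq: "relboundaries i K L = subspace_plus (boundaries i K) (chains i L)"
  by (auto simp: relboundaries_def subspace_plus_def)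

lemma relboundaries_empty: "relboundaries i K {} = boundaries i K"
  by (auto simp: relboundaries_eq subspace_plus_def chains_empty)

text \<open>The zero, sum and scalar multiples of cosets do not depend on the carrier, so the
  quotient of the relative cycles sits inside the quotient of all of
  \<open>chain_space\<close>.\<close>

lemma rel_homology_eq:
  "rel_homology i K L = quotient_subspace (relcycles i K L) (relboundaries i K L)"
  by (auto simp: rel_homology_def quotient_subspace_def quotient_space_def coset_def
      A_RCOSETS_def' set_add_def' a_r_coset_def' fun_eq_iff)

context
  fixes K :: "nat set set"
  assumes K: "face_complex K"
begin

lemma boundaries_subset: "boundaries i K \<subseteq> cycles i K"
  using chain_boundary_chains[OF K, of _ "i + 1"] chain_boundary_chains_twice[OF K]
  by (auto simp: cycles_eq)

lemma cycles_subset: "cycles i K \<subseteq> chains i K"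
  by (auto simp: cycles_eq)

lemma sdim_cycles:
  "sdim (cycles i K :: 'k::field chain set) + sdim (boundaries (i - 1) K :: 'k chain set) = num_faces i K"
  and lin_closed_boundaries: "lin_closed (boundaries i K :: 'k chain set)"
  and lin_closed_cycles: "lin_closed (cycles i K :: 'k chain set)"
proof -
  note rn = chain_map_rank_nullity[where f = chain_boundary, OF chains_dim(1)[OF K] chain_boundary_add[OF K]
      chain_boundary_smult[OF K]]
  show "sdim (cycles i K :: 'k chain set) + sdim (boundaries (i - 1) K :: 'k chain set) = num_faces i K"
    using rn(1) by (simp add: cycles_eq chains_dim(2)[OF K, symmetric, where 'k = 'k] add.commute)
  show "lin_closed (boundaries i K :: 'k chain set)"
    by (rule rn(2))
  show "lin_closed (cycles i K :: 'k chain set)"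
    unfolding cycles_eq by (rule rn(3))
qed

end

subsection \<open>Dimensions of homology\<close>

lemma chains_singleton:
  assumes "\<And>F. F \<in> K \<Longrightarrow> int (card F) \<noteq> i + 1"
  shows "chains i K = {\<lambda>F. 0}"
  using assms by (force simp: chains_def)

lemma sdim_zero: "sdim {\<lambda>F. 0 :: 'k::field} = 0"
  using supported_on_dim(2)[of "{}", where 'k = 'k] by (simp add: supported_on_def flip: fun_eq_iff)

lemma sdim_mono:
  assumes "fin_subspace T" "lin_closed S" "S \<subseteq> T"
  shows "sdim S \<le> sdim T"
  using quotient_subspace_dim(1)[OF assms(1,2)] assms(3) by (simp add: Int_absorb1)

context
  fixes K :: "nat set set"
  assumes K: "face_complex K"
begin

lemma fin_subspace_chains_subset:
  "lin_closed S \<Longrightarrow> S \<subseteq> chains i K \<Longrightarrow> fin_subspace (S :: 'k::field chain set)"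
  using fin_subspace_subset chains_dim(1)[OF K] by blast

lemma reduced_homology_dim:
  "vectorspace.dim class_ring (reduced_homology i K :: ('k::field, 'k chain set) module) +
     sdim (boundaries i K :: 'k chain set) = sdim (cycles i K :: 'k chain set)"
  using quotient_subspace_dim(1)[OF fin_subspace_chains_subset[OF lin_closed_cycles[OF K] cycles_subset[OF K]]
      lin_closed_boundaries[OF K], where 'a = 'k, of i i] boundaries_subset[OF K, of i, where 'a = 'k]
  by (simp add: rel_homology_eq relboundaries_empty Int_absorb1)

lemma reduced_homology_vectorspace:
  shows "vectorspace class_ring (reduced_homology i K :: ('k::field, 'k chain set) module)"
    and "vectorspace.fin_dim class_ring (reduced_homology i K :: ('k::field, 'k chain set) module)"
  using quotient_subspace_dim(2,3)[OF fin_subspace_chains_subset[OF lin_closed_cycles[OF K] cycles_subset[OF K]]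
      lin_closed_boundaries[OF K], where 'a = 'k, of i i]
  by (simp_all add: rel_homology_eq relboundaries_empty)

lemma betti_dim:
  "betti TYPE('k::field) i K + sdim (boundaries i K :: 'k chain set) +
     sdim (boundaries (i - 1) K :: 'k chain set) = num_faces i K"
  using reduced_homology_dim[where 'k = 'k, of i] sdim_cycles[OF K, where 'k = 'k, of i]
  by (simp add: betti_def)

lemma betti_minus_one:
  assumes "{v} \<in> K"
  shows "betti TYPE('k::field) (-1) K = 0"
proof -
  have "cycles (-1) K \<subseteq> (boundaries (-1) K :: 'k chain set)"
  proof
    fix c :: "'k chain" assume "c \<in> cycles (-1) K"
    then have "F = {}" if "c F \<noteq> 0" for F
      using that face_complex_finite_face[OF K, of F] by (auto simp: cycles_eq chains_def)
    then have c: "c = (\<lambda>G. if G = {} then c {} else 0)"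
      by (auto simp: fun_eq_iff)
    \<comment> \<open>A cycle in degree -1 is a multiple of the empty face; the same multiple of the
      vertex \<open>v\<close> has it as its boundary.\<close>
    define b where "b = (\<lambda>F. if F = {v} then c {} else 0)"
    have supp: "b \<in> supported_on (Pow {v})"
      by (auto simp: b_def supported_on_def split: if_splits)
    have "chain_boundary b G = c G" for G
      unfolding chain_boundary_eq[OF _ supp, of G, simplified] fun_cong[OF c, of G]
      by (cases "G = {}") (auto simp: b_def incidence_def)
    then have "c = chain_boundary b" by auto
    moreover have "b \<in> chains (-1 + 1) K"
      using assms by (auto simp: chains_def b_def split: if_splits)
    ultimately show "c \<in> boundaries (-1) K" by blast
  qed
  then have "cycles (-1) K = (boundaries (-1) K :: 'k chain set)"
    using boundaries_subset[OF K] by blast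
  then show ?thesis
    using reduced_homology_dim[of "-1", where 'k = 'k] by (simp add: betti_def)
qed

text \<open>By \<open>betti_dim\<close> each rank of boundaries enters two consecutive face numbers,
  so the alternating sum telescopes down to the rank at the top. It starts from nothing because
  there are no chains below degree -1.\<close>

lemma betti_partial_euler_sum:
  "(\<Sum>k\<le>n. (-1) ^ k * int (betti TYPE('k::field) (int k - 1) K)) +
     (-1) ^ n * int (sdim (boundaries (int n - 1) K :: 'k chain set)) =
   (\<Sum>k\<le>n. (-1) ^ k * int (num_faces (int k - 1) K))"
proof (induction n)
  case 0
  have "(boundaries (- 2) K :: 'k chain set) \<subseteq> chains (- 2) K"
    using boundaries_subset[OF K] cycles_subset[OF K] by blast
  moreover have "chains (- 2) K = {\<lambda>F. 0 :: 'k}"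
    by (rule chains_singleton) simp
  ultimately have "(boundaries (- 2) K :: 'k chain set) = {\<lambda>F. 0}"
    using lin_closed_zero[OF lin_closed_boundaries[OF K]]
    by (metis subset_singleton_iff empty_iff)
  then show ?case
    using betti_dim[where 'k = 'k, of "-1"] by (simp add: sdim_zero)
next
  case (Suc n)
  have "int (num_faces (int (Suc n) - 1) K) = int (betti TYPE('k) (int (Suc n) - 1) K) +
      int (sdim (boundaries (int (Suc n) - 1) K :: 'k chain set)) +
      int (sdim (boundaries (int n - 1) K :: 'k chain set))"
    using betti_dim[where 'k = 'k, of "int (Suc n) - 1"] by simp
  then show ?case
    using Suc by (simp add: algebra_simps)
qed

lemma euler_poincare:
  assumes "\<And>F. F \<in> K \<Longrightarrow> card F \<le> n"
  shows "(\<Sum>k\<le>n. (-1) ^ k * int (betti TYPE('k::field) (int k - 1) K)) = (\<Sum>F\<in>K. (-1) ^ card F)"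
proof -
  have fin: "finite K" using K by (rule face_complex_finite)
  \<comment> \<open>No face has more than \<open>n\<close> elements, so there are no chains in
    degree \<open>n\<close> and the leftover rank is 0.\<close>
  have "(chains (int n) K :: 'k chain set) = {\<lambda>F. 0}"
    using assms by (intro chains_singleton) fastforce
  then have "(boundaries (int n - 1) K :: 'k chain set) = {\<lambda>F. 0}"
    using lin_closed_zero[OF lin_closed_boundaries[OF K, of "int n - 1", where 'k = 'k]] by auto
  then have "(\<Sum>k\<le>n. (-1) ^ k * int (betti TYPE('k) (int k - 1) K)) =
      (\<Sum>k\<le>n. (-1) ^ k * int (num_faces (int k - 1) K))"
    using betti_partial_euler_sum[where 'k = 'k, of n] by (simp add: sdim_zero)
  also have "\<dots> = (\<Sum>k\<le>n. \<Sum>F\<in>{F \<in> K. card F = k}. (-1) ^ card F)"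
    by (simp add: num_faces_def mult.commute)
  also have "\<dots> = (\<Sum>F\<in>K. (-1) ^ card F)"
    using assms by (intro sum.group fin) auto
  finally show ?thesis .
qed

end

section \<open>The homology of a pair and the rank of \<psi>\<close>

context
  fixes K L :: "nat set set"
  assumes K: "face_complex K" and L: "face_complex L" and LK: "L \<subseteq> K"
begin

lemma lin_closed_relboundaries: "lin_closed (relboundaries i K L)"
  unfolding relboundaries_eq by (intro lin_closed_plus lin_closed_boundaries K lin_closed_chains)

lemma boundaries_subset_chains: "boundaries i K \<subseteq> chains i K"
  using boundaries_subset[OF K] cycles_subset[OF K] by blast

text \<open>On relative cycles the boundary operator has the absolute cycles as kernel and the
  boundaries of \<open>K\<close> lying in \<open>L\<close> as image.\<close>

lemma relcycles_rank_nullity: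
  "sdim (relcycles i K L :: 'k::field chain set) =
     sdim (cycles i K :: 'k chain set) + sdim (boundaries (i - 1) K \<inter> chains (i - 1) L :: 'k chain set)"
  and lin_closed_relcycles: "lin_closed (relcycles i K L :: 'k chain set)"
proof -
  show lc: "lin_closed (relcycles i K L :: 'k chain set)"
  proof (rule lin_closedI)
    have "chain_boundary (\<lambda>F. 0) = (\<lambda>F. 0 :: 'k)"
      by (simp add: chain_boundary_def)
    then show "(\<lambda>F. 0 :: 'k) \<in> relcycles i K L"
      by (simp add: relcycles_def chains_def)
  next
    fix x y :: "'k chain" assume "x \<in> relcycles i K L" "y \<in> relcycles i K L"
    then have *: "x \<in> chains i K" "y \<in> chains i K"
      "chain_boundary x \<in> chains (i - 1) L" "chain_boundary y \<in> chains (i - 1) L"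
      by (simp_all add: relcycles_def)
    then show "(\<lambda>F. x F + y F) \<in> relcycles i K L"
      using lin_closed_add[OF lin_closed_chains *(1,2)] lin_closed_add[OF lin_closed_chains *(3,4)]
      by (simp add: relcycles_def chain_boundary_add[OF K *(1,2)])
  next
    fix a :: 'k and x :: "'k chain" assume "x \<in> relcycles i K L"
    then have *: "x \<in> chains i K" "chain_boundary x \<in> chains (i - 1) L"
      by (simp_all add: relcycles_def)
    then show "(\<lambda>F. a * x F) \<in> relcycles i K L"
      using lin_closed_smult[OF lin_closed_chains *(1)] lin_closed_smult[OF lin_closed_chains *(2)]
      by (simp add: relcycles_def chain_boundary_smult[OF K *(1)])
  qed
  have sub: "relcycles i K L \<subseteq> (chains i K :: 'k chain set)"
    by (auto simp: relcycles_def)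
  have "{x \<in> relcycles i K L. chain_boundary x = (\<lambda>F. 0)} = (cycles i K :: 'k chain set)"
    by (auto simp: cycles_eq) (auto simp: relcycles_def chains_def)
  moreover have "chain_boundary ` relcycles i K L = boundaries (i - 1) K \<inter> (chains (i - 1) L :: 'k chain set)"
    by (auto simp: relcycles_def)
  moreover have "sdim (chain_boundary ` relcycles i K L :: 'k chain set) +
      sdim {x \<in> relcycles i K L. chain_boundary x = (\<lambda>F. 0 :: 'k)} = sdim (relcycles i K L :: 'k chain set)"
    using sub by (intro chain_map_rank_nullity(1)[where f = chain_boundary]
        fin_subspace_chains_subset[OF K lc sub] chain_boundary_add[OF K, of _ i] chain_boundary_smult[OF K, of
            _ i]) auto
  ultimately show "sdim (relcycles i K L :: 'k::field chain set) =
     sdim (cycles i K :: 'k chain set) + sdim (boundaries (i - 1) K \<inter> chains (i - 1) L :: 'k chain set)"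
    by simp
qed

lemma chains_Int_cycles: "chains i L \<inter> cycles i K = cycles i L"
  using chains_mono[OF LK] by (auto simp: cycles_eq)

lemma relboundaries_subset_relcycles: "relboundaries i K L \<subseteq> relcycles i K L"
proof
  fix x :: "'k::field chain" assume "x \<in> relboundaries i K L"
  then obtain b a where ba: "b \<in> boundaries i K" "a \<in> chains i L" "x = (\<lambda>F. b F + a F)"
    by (auto simp: relboundaries_eq elim!: subspace_plusE)
  then have *: "b \<in> chains i K" "chain_boundary b = (\<lambda>F. 0)" "a \<in> chains i K"
    using boundaries_subset[OF K, of i] chains_mono[OF LK] by (auto simp: cycles_eq)
  show "x \<in> relcycles i K L"
    using chain_boundary_chains[OF L ba(2)] lin_closed_add[OF lin_closed_chains *(1,3)]
    by (simp add: relcycles_def ba(3) chain_boundary_add[OF K *(1,3)] *(2))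
qed

text \<open>The modular law, since boundaries are cycles. Modulo boundaries this is exactness at the
  homology of \<open>K\<close>: the kernel of \<psi> consists of the classes of cycles of
  \<open>L\<close>.\<close>

lemma cycles_Int_relboundaries:
  "cycles i K \<inter> relboundaries i K L = subspace_plus (boundaries i K) (cycles i L)"
proof (intro equalityI subsetI)
  fix x :: "'k::field chain" assume x: "x \<in> cycles i K \<inter> relboundaries i K L"
  then obtain b a where ba: "b \<in> boundaries i K" "a \<in> chains i L" "x = (\<lambda>F. b F + a F)"
    by (auto simp: relboundaries_eq elim!: subspace_plusE)
  have "b \<in> cycles i K" using ba(1) boundaries_subset[OF K] by blast
  then have "(\<lambda>F. x F - b F) \<in> cycles i K"
    using x by (intro lin_closed_diff[OF lin_closed_cycles[OF K]]) auto
  then have "a \<in> cycles i L"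
    using ba(2,3) chains_Int_cycles by auto
  then show "x \<in> subspace_plus (boundaries i K) (cycles i L)"
    using ba by (auto intro: subspace_plusI)
next
  fix x :: "'k::field chain" assume "x \<in> subspace_plus (boundaries i K) (cycles i L)"
  then obtain b a where ba: "b \<in> boundaries i K" "a \<in> cycles i L" "x = (\<lambda>F. b F + a F)"
    by (auto elim!: subspace_plusE)
  have "b \<in> cycles i K" "a \<in> cycles i K" "a \<in> chains i L"
    using ba(1,2) boundaries_subset[OF K] chains_Int_cycles by blast+
  then show "x \<in> cycles i K \<inter> relboundaries i K L"
    using ba lin_closed_add[OF lin_closed_cycles[OF K]]
    by (auto simp: relboundaries_eq intro: subspace_plusI)
qed

lemma rel_homology_vectorspace:
  shows "vectorspace class_ring (rel_homology i K L :: ('k::field, 'k chain set) module)"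
    and "vectorspace.fin_dim class_ring (rel_homology i K L :: ('k::field, 'k chain set) module)"
    and "vectorspace.dim class_ring (rel_homology i K L :: ('k::field, 'k chain set) module) +
      sdim (relboundaries i K L :: 'k chain set) = sdim (relcycles i K L :: 'k chain set)"
proof -
  have "fin_subspace (relcycles i K L :: 'k chain set)"
    by (rule fin_subspace_chains_subset[OF K lin_closed_relcycles]) (auto simp: relcycles_def)
  note q = quotient_subspace_dim[OF this lin_closed_relboundaries, of i]
  show "vectorspace class_ring (rel_homology i K L :: ('k::field, 'k chain set) module)"
    and "vectorspace.fin_dim class_ring (rel_homology i K L :: ('k::field, 'k chain set) module)"
    and "vectorspace.dim class_ring (rel_homology i K L :: ('k::field, 'k chain set) module) +
      sdim (relboundaries i K L :: 'k chain set) = sdim (relcycles i K L :: 'k chain set)"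
    using q relboundaries_subset_relcycles[of i, where 'a = 'k]
    by (simp_all add: rel_homology_eq Int_absorb1)
qed

lemma psi_coset: "psi i K L (coset (boundaries i K) c) = coset (relboundaries i K L) c"
proof -
  have "boundaries i K \<subseteq> relboundaries i K L"
    unfolding relboundaries_eq by (rule subspace_plus_upper(1)[OF lin_closed_boundaries[OF K] lin_closed_chains])
  moreover have "coset (boundaries i K) c \<noteq> {}"
    using coset_self[OF lin_closed_boundaries[OF K], of c i] by blast
  ultimately show ?thesis
    unfolding psi_def coset_def[symmetric]
    by (intro Union_coset[OF lin_closed_relboundaries])
      (auto simp: mem_coset[OF lin_closed_boundaries[OF K]])
qed

lemma dim_im_psi_eq:
  "dim_im_psi TYPE('k::field) i K L + sdim (cycles i K \<inter> relboundaries i K L :: 'k chain set) =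
    sdim (cycles i K :: 'k chain set)"
proof -
  have "psi i K L ` carrier (reduced_homology i K :: ('k, 'k chain set) module) =
      coset (relboundaries i K L) ` cycles i K"
    by (simp add: rel_homology_eq quotient_subspace_def relboundaries_empty image_image psi_coset)
  then have "dim_im_psi TYPE('k) i K L =
      vectorspace.dim class_ring (quotient_subspace (cycles i K) (relboundaries i K L :: 'k chain set))"
    by (simp add: dim_im_psi_def rel_homology_eq quotient_subspace_def)
  then show ?thesis
    using quotient_subspace_dim(1)[OF fin_subspace_chains_subset[OF K lin_closed_cycles[OF K] cycles_subset[OF K]]
      lin_closed_relboundaries, where 'a = 'k, of i i] by simp
qed

text \<open>Needed in degree -1, where it forces the image of \<psi> to vanish and so provides the
  start \<open>p 0 = 0\<close> for \<open>alternating_sum_duality\<close>.\<close>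

lemma dim_im_psi_le_betti: "dim_im_psi TYPE('k::field) i K L \<le> betti TYPE('k) i K"
proof -
  have "sdim (boundaries i K :: 'k chain set) \<le> sdim (cycles i K \<inter> relboundaries i K L :: 'k chain set)"
  proof (rule sdim_mono)
    have lc: "lin_closed (cycles i K \<inter> relboundaries i K L :: 'k chain set)"
      by (intro lin_closed_Int lin_closed_cycles[OF K] lin_closed_relboundaries)
    then show "fin_subspace (cycles i K \<inter> relboundaries i K L :: 'k chain set)"
      using cycles_subset[OF K] by (intro fin_subspace_chains_subset[OF K, of _ i]) auto
    show "lin_closed (boundaries i K :: 'k chain set)"
      by (rule lin_closed_boundaries[OF K])
    show "boundaries i K \<subseteq> (cycles i K \<inter> relboundaries i K L :: 'k chain set)"
      unfolding cycles_Int_relboundaries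
      by (rule subspace_plus_upper(1)[OF lin_closed_boundaries[OF K] lin_closed_cycles[OF L]])
  qed
  then show ?thesis
    using dim_im_psi_eq[of i, where 'k = 'k] reduced_homology_dim[OF K, of i, where 'k = 'k]
    by (simp add: betti_def)
qed

text \<open>The exact sequence of the pair, with the dimension of the image of \<open>\<psi>\<close> in two consecutive
  degrees in place of the connecting homomorphism.\<close>

lemma rel_homology_dim:
  "int (vectorspace.dim class_ring (rel_homology i K L :: ('k::field, 'k chain set) module)) =
    int (dim_im_psi TYPE('k) i K L) + int (dim_im_psi TYPE('k) (i - 1) K L)
    + int (betti TYPE('k) (i - 1) L) - int (betti TYPE('k) (i - 1) K)"
proof -
  have finC: "fin_subspace (chains j K :: 'k chain set)" for j
    by (rule chains_dim(1)[OF K])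
  have sub: "cycles j L \<subseteq> (chains j K :: 'k chain set)" for j
    using cycles_subset[OF L] chains_mono[OF LK] by blast
  have Int: "boundaries j K \<inter> cycles j L = (boundaries j K \<inter> chains j L :: 'k chain set)" for j
    using boundaries_subset[OF K, of j] chains_Int_cycles[of j] by blast
  \<comment> \<open>The cycles of \<open>L\<close> that bound in \<open>K\<close> are the common
    unknown: in degree \<open>i\<close> they enter both \<open>1\<close> and \<open>2\<close>, in
    degree \<open>i - 1\<close> both \<open>1\<close> and \<open>relcycles_rank_nullity\<close>, so
    their dimensions drop out.\<close>
  have 1: "sdim (cycles j K \<inter> relboundaries j K L :: 'k chain set) +
      sdim (boundaries j K \<inter> chains j L :: 'k chain set) =
      sdim (boundaries j K :: 'k chain set) + sdim (cycles j L :: 'k chain set)" for j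
    using sdim_plus[OF finC lin_closed_boundaries[OF K] lin_closed_cycles[OF L] boundaries_subset_chains sub, of j]
    by (simp add: cycles_Int_relboundaries Int)
  have 2: "sdim (relboundaries i K L :: 'k chain set) +
      sdim (boundaries i K \<inter> chains i L :: 'k chain set) =
      sdim (boundaries i K :: 'k chain set) + num_faces i L"
    using sdim_plus[OF finC lin_closed_boundaries[OF K] lin_closed_chains boundaries_subset_chains
      chains_mono[OF LK], of i] by (simp add: relboundaries_eq chains_dim(2)[OF L])
  show ?thesis
    using 1[of i] 1[of "i - 1"] 2 rel_homology_vectorspace(3)[of i, where 'k = 'k]
      relcycles_rank_nullity[of i, where 'k = 'k]
      dim_im_psi_eq[of i, where 'k = 'k] dim_im_psi_eq[of "i - 1", where 'k = 'k]
      reduced_homology_dim[OF K, of "i - 1", where 'k = 'k] reduced_homology_dim[OF L, of "i - 1", where 'k = 'k]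
      sdim_cycles[OF L, of i, where 'k = 'k]
    by (simp add: betti_def)
qed

end

subsection \<open>The \<open>h\<close>-polynomial and the links\<close>

definition h_poly :: "nat \<Rightarrow> nat set set \<Rightarrow> int poly" where
  "h_poly D K = (\<Sum>F\<in>K. [:0, 1:] ^ card F * [:1, -1:] ^ (D - card F))"

text \<open>The reversal of \<open>h_poly D K\<close>: substituting 1/x for x and multiplying by x^D
  turns x^k (1 - x)^(D - k) into (x - 1)^(D - k).\<close>

definition h_poly_rev :: "nat \<Rightarrow> nat set set \<Rightarrow> int poly" where
  "h_poly_rev D K = (\<Sum>F\<in>K. (- [:1, -1:]) ^ (D - card F))"

lemma h_number_eq_coeff:
  assumes "finite K" "\<And>F. F \<in> K \<Longrightarrow> card F \<le> D"
  shows "h_number D K i = coeff (h_poly D K) i"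
proof -
  have "(\<Sum>j\<le>D. of_nat (num_faces (int j - 1) K) * [:0, 1:] ^ j * [:1, -1:] ^ (D - j)) =
      (\<Sum>j\<le>D. \<Sum>F\<in>{F \<in> K. card F = j}. [:0, 1:] ^ card F * ([:1, -1:] ^ (D - card F) :: int poly))"
    by (simp add: num_faces_def mult.assoc)
  also have "\<dots> = h_poly D K"
    unfolding h_poly_def using assms by (intro sum.group) auto
  finally show ?thesis by (simp add: h_number_def)
qed

lemma coeff_monomial_rev:
  assumes "k \<le> D" "i \<le> D"
  shows "coeff ([:0, 1:] ^ k * [:1, -1:] ^ (D - k)) (D - i) =
    coeff ((- [:1, -1:]) ^ (D - k) :: int poly) i"
proof -
  have X: "[:0, 1:] ^ k = (monom 1 k :: int poly)"
    by (simp add: monom_altdef)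
  show ?thesis
  proof (cases "i \<le> D - k")
    case True
    then have "D - i - k = (D - k) - i" "\<not> D - i < k"
      using assms by auto
    then show ?thesis
      using True unfolding X coeff_monom_mult
      by (simp add: coeff_linear_poly_power binomial_symmetric[of i])
  next
    case False
    have "degree ((- [:1, -1:] :: int poly) ^ (D - k)) \<le> D - k"
      using degree_power_le[of "- [:1, -1:] :: int poly" "D - k"] by simp
    then have "coeff ((- [:1, -1:] :: int poly) ^ (D - k)) i = 0"
      using False by (intro coeff_eq_0) simp
    moreover have "D - i < k"
      using False assms by simp
    ultimately show ?thesis
      unfolding X coeff_monom_mult by simp
  qed
qed

lemma coeff_h_poly_rev:
  assumes "\<And>F. F \<in> K \<Longrightarrow> card F \<le> D" "i \<le> D"
  shows "coeff (h_poly D K) (D - i) = coeff (h_poly_rev D K) i"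
  unfolding h_poly_def h_poly_rev_def coeff_sum using assms
  by (intro sum.cong refl coeff_monomial_rev)

lemma h_poly_link_expansion:
  assumes K: "face_complex K" and card: "\<And>F. F \<in> K \<Longrightarrow> card F \<le> D"
  shows "h_poly D K =
    (\<Sum>F\<in>K. [:1, -1:] ^ (D - card F) * of_int (\<Sum>H\<in>link K F. (-1) ^ card H))"
proof -
  let ?Y = "[:1, -1:] :: int poly"
  have fin: "finite K" and finF: "\<And>F. F \<in> K \<Longrightarrow> finite F"
    using face_complex_finite[OF K] face_complex_finite_face[OF K] by auto
  have "h_poly D K = (\<Sum>G\<in>K. \<Sum>F\<in>Pow G. (-1) ^ (card G - card F) * ?Y ^ (D - card F))"
    unfolding h_poly_def
  proof (rule sum.cong[OF refl])
    fix G assume G: "G \<in> K"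
    \<comment> \<open>As a product over the vertices of \<open>G\<close>, the binomial expansion is
      indexed by the faces \<open>F\<close> of \<open>G\<close>, so that the order of summation over
      \<open>F\<close> and \<open>G\<close> can be exchanged.\<close>
    have "[:0, 1:] ^ card G = (\<Prod>x\<in>G. 1 + (- ?Y))"
      by (simp add: one_pCons)
    also have "\<dots> = (\<Sum>F\<in>Pow G. (- ?Y) ^ (card G - card F))"
      unfolding prod_add[OF finF[OF G]]
      by (intro sum.cong refl) (use finF[OF G] in \<open>auto simp: card_Diff_subset finite_subset\<close>)
    also have "\<dots> * ?Y ^ (D - card G) = (\<Sum>F\<in>Pow G. (-1) ^ (card G - card F) * ?Y ^ (D - card F))"
      unfolding sum_distrib_right
    proof (rule sum.cong[OF refl])
      fix F assume "F \<in> Pow G"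
      then have "card F \<le> card G" using finF[OF G] by (auto intro: card_mono)
      then have "D - card F = (card G - card F) + (D - card G)"
        using card[OF G] by simp
      then show "(- ?Y) ^ (card G - card F) * ?Y ^ (D - card G) =
          (-1) ^ (card G - card F) * ?Y ^ (D - card F)"
        by (simp only: power_add power_minus[of ?Y] mult.assoc)
    qed
    finally show "[:0, 1:] ^ card G * ?Y ^ (D - card G) =
      (\<Sum>F\<in>Pow G. (-1) ^ (card G - card F) * ?Y ^ (D - card F))" .
  qed
  also have "\<dots> = (\<Sum>G\<in>K. \<Sum>F\<in>{F \<in> K. F \<subseteq> G}. (-1) ^ (card G - card F) * ?Y ^ (D - card F))"
    using K by (intro sum.cong refl) (auto simp: face_complex_def)
  also have "\<dots> = (\<Sum>F\<in>K. \<Sum>G\<in>{G \<in> K. F \<subseteq> G}. (-1) ^ (card G - card F) * ?Y ^ (D - card F))"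
    by (rule sum.swap_restrict[OF fin fin])
  also have "\<dots> = (\<Sum>F\<in>K. ?Y ^ (D - card F) * of_int (\<Sum>H\<in>link K F. (-1) ^ card H))"
  proof (rule sum.cong[OF refl])
    fix F assume F: "F \<in> K"
    have "(\<Sum>G\<in>{G \<in> K. F \<subseteq> G}. (-1) ^ (card G - card F) * ?Y ^ (D - card F)) =
        (\<Sum>H\<in>link K F. (-1) ^ card H * ?Y ^ (D - card F))"
    proof (rule sum.reindex_bij_witness[of _ "\<lambda>H. H \<union> F" "\<lambda>G. G - F"])
      fix G assume G: "G \<in> {G \<in> K. F \<subseteq> G}"
      then show "G - F \<union> F = G" by auto
      show "G - F \<in> link K F"
        using G K by (auto simp: link_def face_complex_def Un_absorb2)
      show "(-1) ^ card (G - F) * ?Y ^ (D - card F) = (-1) ^ (card G - card F) * ?Y ^ (D - card F)"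
        using G finF[OF F] by (simp add: card_Diff_subset)
    qed (auto simp: link_def)
    then show "(\<Sum>G\<in>{G \<in> K. F \<subseteq> G}. (-1) ^ (card G - card F) * ?Y ^ (D - card F)) =
        ?Y ^ (D - card F) * of_int (\<Sum>H\<in>link K F. (-1) ^ card H)"
      by (simp add: sum_distrib_right[symmetric] mult.commute)
  qed
  finally show ?thesis .
qed

text \<open>At 0 only the empty face contributes. This normalization later fixes the constant in the
  Dehn-Sommerville relation.\<close>

lemma poly_h_poly_0:
  assumes "face_complex K" "{} \<in> K"
  shows "poly (h_poly D K) 0 = 1"
proof -
  have "poly (h_poly D K) 0 = (\<Sum>F\<in>K. 0 ^ card F)"
    by (simp add: h_poly_def poly_sum)
  also have "\<dots> = (\<Sum>F\<in>K. if F = {} then 1 else 0)"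
    using face_complex_finite_face[OF assms(1)] by (intro sum.cong refl) (auto simp: power_0_left)
  also have "\<dots> = 1"
    using face_complex_finite[OF assms(1)] assms(2) by simp
  finally show ?thesis .
qed

lemma minus_one_power_diff:
  "k \<le> n \<Longrightarrow> (-1 :: 'a::comm_ring_1) ^ (n - k) = (-1) ^ n * (-1) ^ k"
  by (auto simp: le_iff_add power_add mult_ac)

lemma poly_h_poly_rev_0:
  assumes "\<And>F. F \<in> K \<Longrightarrow> card F \<le> D"
  shows "poly (h_poly_rev D K) 0 = (-1) ^ D * (\<Sum>F\<in>K. (-1) ^ card F)"
  unfolding h_poly_rev_def poly_sum sum_distrib_left
  by (intro sum.cong refl) (simp add: assms minus_one_power_diff)

section \<open>Links in a homology manifold\<close>

lemma simplicial_complex_face_complex: "simplicial_complex_on V K \<Longrightarrow> face_complex K"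
  unfolding simplicial_complex_on_def face_complex_def
  using finite_subset[of "\<Union>K" V] by auto

lemma pure_complex_card_le:
  assumes "face_complex K" "pure_complex d K" "F \<in> K"
  shows "card F \<le> d"
proof -
  obtain G where G: "G \<in> K" "F \<subseteq> G" "\<forall>H\<in>K. G \<subseteq> H \<longrightarrow> G = H"
    using finite_has_maximal2[OF face_complex_finite[OF assms(1)] assms(3)] by blast
  then have "card G = d"
    using assms(2) by (auto simp: pure_complex_def facets_def)
  then show ?thesis
    using card_mono[OF face_complex_finite_face[OF assms(1) G(1)] G(2)] by simp
qed

lemma face_complex_link:
  assumes "face_complex K"
  shows "face_complex (link K F)"
proof -
  have down: "G \<in> K \<Longrightarrow> H \<subseteq> G \<Longrightarrow> H \<in> K" for G H
    using assms unfolding face_complex_def by blast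
  have "\<Union>(link K F) \<subseteq> \<Union>K" by (auto simp: link_def)
  then have "finite (\<Union>(link K F))"
    using assms finite_subset unfolding face_complex_def by blast
  moreover have "H \<in> link K F" if "G \<in> link K F" "H \<subseteq> G" for G H
    using that down[of G H] down[of "G \<union> F" "H \<union> F"] unfolding link_def by blast
  ultimately show ?thesis
    by (auto simp: face_complex_def)
qed

lemma betti_zero_space:
  assumes "face_complex K" "zero_space (reduced_homology i K :: ('k::field, 'k chain set) module)"
  shows "betti TYPE('k) i K = 0"
  unfolding betti_def using assms by (intro zero_space_dim reduced_homology_vectorspace)

lemma betti_field_space:
  assumes "face_complex K"
    "iso_spaces (reduced_homology i K :: ('k::field, 'k chain set) module) (field_space :: ('k, 'k) module)"
  shows "betti TYPE('k) i K = 1"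
  unfolding betti_def
  using iso_spaces_dim[OF assms(2) reduced_homology_vectorspace(1)[OF assms(1)]
      vectorspace_field_space reduced_homology_vectorspace(2)[OF assms(1)]] dim_field_space
  by metis

lemma homology_manifold_links_complex:
  assumes "homology_manifold_links TYPE('k::field) d K"
  shows "face_complex K" "pure_complex d K" "{} \<in> K"
proof -
  have "simplicial_complex_on (\<Union>K) K"
    using assms by (simp add: homology_manifold_links_def)
  then show "face_complex K" "{} \<in> K"
    using simplicial_complex_face_complex by (blast, simp add: simplicial_complex_on_def)
  show "pure_complex d K"
    using assms by (simp add: homology_manifold_links_def)
qed

text \<open>In the Euler-Poincare formula for the link only the top degree survives, and its Betti
  number is 0 on the boundary and 1 in the interior.\<close>

lemma link_euler:
  assumes man: "homology_manifold_links TYPE('k::field) d K" and F: "F \<in> K" "F \<noteq> {}"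
  shows "(\<Sum>H\<in>link K F. (-1) ^ card H) =
    (if F \<in> boundary_faces TYPE('k) d K then 0 else (-1 :: int) ^ (d - card F))"
proof -
  note K = homology_manifold_links_complex(1)[OF man] and pure = homology_manifold_links_complex(2)[OF man]
  note L = face_complex_link[OF K, of F]
  have Fd: "card F \<le> d" and finF: "finite F"
    using pure_complex_card_le[OF K pure F(1)] face_complex_finite_face[OF K F(1)] .
  define n where "n = d - card F"
  have n: "int d - int (card F) - 1 = int n - 1"
    using Fd by (simp add: n_def)
  have "card H \<le> n" if "H \<in> link K F" for H
  proof -
    have "H \<union> F \<in> K" "H \<inter> F = {}" "finite H"
      using that face_complex_finite_face[OF K] by (auto simp: link_def)
    then have "card H + card F \<le> d"
      using pure_complex_card_le[OF K pure, of "H \<union> F"] finF by (simp add: card_Un_disjoint)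
    then show ?thesis by (simp add: n_def)
  qed
  from euler_poincare[OF L this, where 'k = 'k]
  have "(\<Sum>H\<in>link K F. (-1) ^ card H) =
      (\<Sum>k\<le>n. (-1) ^ k * int (betti TYPE('k) (int k - 1) (link K F)))" by simp
  also have "\<dots> = (\<Sum>k\<le>n. if k = n then (-1) ^ n * int (betti TYPE('k) (int n - 1) (link K F)) else 0)"
  proof (rule sum.cong[OF refl])
    fix k assume "k \<in> {..n}"
    then have "k \<noteq> n \<Longrightarrow> betti TYPE('k) (int k - 1) (link K F) = 0"
      using man F by (intro betti_zero_space[OF L])
        (auto simp: homology_manifold_links_def n)
    then show "(-1) ^ k * int (betti TYPE('k) (int k - 1) (link K F)) =
        (if k = n then (-1) ^ n * int (betti TYPE('k) (int n - 1) (link K F)) else 0)"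
      by auto
  qed
  also have "\<dots> = (-1) ^ n * int (betti TYPE('k) (int n - 1) (link K F))"
    by simp
  also have "\<dots> = (if F \<in> boundary_faces TYPE('k) d K then 0 else (-1) ^ n)"
  proof (cases "F \<in> boundary_faces TYPE('k) d K")
    case True
    then show ?thesis
      using betti_zero_space[OF L, where 'k = 'k] by (simp add: boundary_faces_def n)
  next
    case False
    then have "iso_spaces (reduced_homology (int n - 1) (link K F) :: ('k, 'k chain set) module)
        (field_space :: ('k, 'k) module)"
      using man F by (auto simp: boundary_faces_def homology_manifold_links_def n Let_def)
    then show ?thesis
      using False betti_field_space[OF L] by simp
  qed
  finally show ?thesis by (simp add: n_def)
qed

text \<open>By \<open>link_euler\<close> the nonempty faces contribute their terms of
  \<open>h_poly_rev\<close> with the boundary faces left out. The empty face, whose link is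
  \<open>K\<close>, gives the Euler term; its term in \<open>h_poly_rev\<close> is cancelled by the
  empty face of \<open>boundary_complex\<close>.\<close>

lemma h_poly_manifold:
  assumes man: "homology_manifold_links TYPE('k::field) d K"
  shows "h_poly d K = [:1, -1:] ^ d * of_int (\<Sum>F\<in>K. (-1) ^ card F) + h_poly_rev d K -
    (\<Sum>F\<in>boundary_complex TYPE('k) d K. (- [:1, -1:]) ^ (d - card F))"
proof -
  let ?Y = "[:1, -1:] :: int poly" and ?B = "boundary_faces TYPE('k) d K"
  let ?e = "\<lambda>F. (\<Sum>H\<in>link K F. (-1) ^ card H) :: int"
  note K = homology_manifold_links_complex(1)[OF man] and pure = homology_manifold_links_complex(2)[OF man]
    and empty = homology_manifold_links_complex(3)[OF man]
  have fin: "finite K" by (rule face_complex_finite[OF K])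
  have pm: "(- ?Y) ^ m = (-1) ^ m * ?Y ^ m" for m
    by (rule power_minus)
  have BK: "?B \<subseteq> K - {{}}" by (auto simp: boundary_faces_def)
  have split: "sum f K = f {} + sum f (K - {{}})" for f :: "nat set \<Rightarrow> int poly"
    using sum.remove[OF fin empty] .
  have "(\<Sum>F\<in>K - {{}}. ?Y ^ (d - card F) * of_int (?e F)) =
      (\<Sum>F\<in>K - {{}}. (if F \<in> ?B then 0 else (- ?Y) ^ (d - card F)))"
    unfolding pm by (intro sum.cong refl) (auto simp: link_euler[OF man] mult.commute)
  also have "\<dots> = (\<Sum>F\<in>K - {{}} - ?B. (- ?Y) ^ (d - card F))"
    using fin by (intro sum.mono_neutral_cong_right) auto
  also have "\<dots> = (\<Sum>F\<in>K - {{}}. (- ?Y) ^ (d - card F)) - (\<Sum>F\<in>?B. (- ?Y) ^ (d - card F))"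
    using fin BK by (intro sum_diff) auto
  finally have "h_poly d K = ?Y ^ d * of_int (?e {}) +
      ((\<Sum>F\<in>K - {{}}. (- ?Y) ^ (d - card F)) - (\<Sum>F\<in>?B. (- ?Y) ^ (d - card F)))"
    using h_poly_link_expansion[OF K pure_complex_card_le[OF K pure]] by (simp add: split)
  moreover have "link K {} = K" by (auto simp: link_def)
  moreover have "(\<Sum>F\<in>boundary_complex TYPE('k) d K. (- ?Y) ^ (d - card F)) =
      (- ?Y) ^ d + (\<Sum>F\<in>?B. (- ?Y) ^ (d - card F))"
    using BK finite_subset[OF BK] fin by (subst boundary_complex_def, subst sum.insert) auto
  moreover have "h_poly_rev d K = (- ?Y) ^ d + (\<Sum>F\<in>K - {{}}. (- ?Y) ^ (d - card F))"
    unfolding h_poly_rev_def split by simp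
  ultimately show ?thesis by simp
qed

subsection \<open>Dehn-Sommerville relations and duality\<close>

lemma h_poly_dehn_sommerville:
  assumes K: "homology_manifold TYPE('k::field) d K" and B: "boundary_faces TYPE('k) d K \<noteq> {}"
  defines "L \<equiv> boundary_complex TYPE('k) d K"
  shows "h_poly_rev d K = h_poly d K - [:1, -1:] * h_poly (d - 1) L +
    [:1, -1:] ^ d * of_int ((-1) ^ d * (\<Sum>F\<in>K. (-1) ^ card F))"
proof -
  let ?Y = "[:1, -1:] :: int poly"
  let ?e = "\<lambda>K. (\<Sum>F\<in>K. (-1) ^ card F) :: int"
  have manK: "homology_manifold_links TYPE('k) d K"
    and manL: "homology_manifold_links TYPE('k) (d - 1) L"
    and closed: "boundary_faces TYPE('k) (d - 1) L = {}"
    using K B by (auto simp: homology_manifold_def L_def)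
  note cK = homology_manifold_links_complex[OF manK] and cL = homology_manifold_links_complex[OF manL]
  note cardK = pure_complex_card_le[OF cK(1,2)] and cardL = pure_complex_card_le[OF cL(1,2)]
  obtain F where F: "F \<in> K" "F \<noteq> {}"
    using B by (auto simp: boundary_faces_def)
  then have "card F > 0"
    using face_complex_finite_face[OF cK(1)] by (simp add: card_gt_0_iff)
  then have "d > 0" using cardK[OF F(1)] by simp
  then have d: "Suc (d - 1) = d" by simp
  \<comment> \<open>The boundary has dimension one less, so measuring its faces against
    \<open>d\<close> leaves one extra factor \<open>- ?Y\<close>.\<close>
  have "(\<Sum>F\<in>L. (- ?Y) ^ (d - card F)) = (\<Sum>F\<in>L. (- ?Y) * (- ?Y) ^ (d - 1 - card F))"
  proof (rule sum.cong[OF refl])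
    fix F assume "F \<in> L"
    then have "d - card F = Suc (d - 1 - card F)"
      using cardL[of F] \<open>d > 0\<close> by simp
    then show "(- ?Y) ^ (d - card F) = (- ?Y) * (- ?Y) ^ (d - 1 - card F)"
      by (simp only: power_Suc)
  qed
  also have "\<dots> = - ?Y * h_poly_rev (d - 1) L"
    by (simp only: h_poly_rev_def sum_distrib_left)
  finally have 1: "h_poly d K = ?Y ^ d * of_int (?e K) + h_poly_rev d K + ?Y * h_poly_rev (d - 1) L"
    using h_poly_manifold[OF manK, folded L_def] by simp
  \<comment> \<open>Without boundary faces the boundary complex of \<open>L\<close> is
    \<open>{{}}\<close>, whose single summand is the last term.\<close>
  have "h_poly (d - 1) L = ?Y ^ (d - 1) * of_int (?e L) + h_poly_rev (d - 1) L - (- ?Y) ^ (d - 1)"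
    using h_poly_manifold[OF manL, unfolded boundary_complex_def closed] by (simp add: power_0_left)
  moreover have "p = q * e + r - s \<Longrightarrow> y * p = (y * q) * e + y * r + (- y) * s"
    for p q e r s y :: "int poly"
    by hypsubst (simp add: algebra_simps)
  ultimately have "?Y * h_poly (d - 1) L =
      ?Y ^ Suc (d - 1) * of_int (?e L) + ?Y * h_poly_rev (d - 1) L + (- ?Y) ^ Suc (d - 1)"
    unfolding power_Suc by blast
  then have 2: "?Y * h_poly (d - 1) L =
      ?Y ^ d * of_int (?e L) + ?Y * h_poly_rev (d - 1) L + (- ?Y) ^ d"
    unfolding d .
  have neg: "(- ?Y) ^ d = (-1) ^ d * ?Y ^ d"
    by (rule power_minus)
  have 3: "h_poly_rev d K = h_poly d K - ?Y * h_poly (d - 1) L +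
      ?Y ^ d * (of_int (?e L) - of_int (?e K) + (-1) ^ d)"
  proof -
    have "p = y * a + r + u \<Longrightarrow> q = y * b + u + s * y \<Longrightarrow> r = p - q + y * (b - a + s)"
      for p q r u y a b s :: "int poly"
      by (simp add: algebra_simps)
    from this[OF 1 2[unfolded neg]] show ?thesis .
  qed
  have poly_const: "poly (of_int a) 0 = a" for a :: int
    by (simp add: of_int_poly)
  \<comment> \<open>Comparing values at 0, where \<open>?Y\<close> and both
    \<open>h\<close>-polynomials equal 1, evaluates the bracket in \<open>3\<close> in terms of
    \<Delta> alone; the Euler characteristic of the boundary never has to be computed.\<close>
  have "poly (h_poly_rev d K) 0 = poly (h_poly d K - ?Y * h_poly (d - 1) L +
      ?Y ^ d * (of_int (?e L) - of_int (?e K) + (-1) ^ d)) 0"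
    by (rule arg_cong[OF 3])
  then have "(-1) ^ d * ?e K = ?e L - ?e K + (-1) ^ d"
    by (simp add: poly_h_poly_0 cK cL poly_h_poly_rev_0 cardK poly_const del: of_int_sum)
  then have "(of_int ((-1) ^ d * ?e K) :: int poly) = of_int (?e L - ?e K + (-1) ^ d)"
    by (rule arg_cong)
  then show ?thesis using 3 by simp
qed

lemma coeff_one_minus_x_power: "coeff ([:1, -1:] ^ d :: int poly) i = (-1) ^ i * int (d choose i)"
proof (cases "i \<le> d")
  case True
  then show ?thesis by (simp add: coeff_linear_poly_power)
next
  case False
  have "degree ([:1, -1:] ^ d :: int poly) \<le> d"
    using degree_power_le[of "[:1, -1:] :: int poly" d] by simp
  then show ?thesis
    using False by (simp add: coeff_eq_0 binomial_eq_0)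
qed

lemma h_number_dehn_sommerville:
  assumes K: "homology_manifold TYPE('k::field) d K" and B: "boundary_faces TYPE('k) d K \<noteq> {}"
    and "i \<le> d"
  defines "L \<equiv> boundary_complex TYPE('k) d K"
  shows "h_number d K (d - i) =
    h_number d K i - (h_number (d - 1) L i - (if i = 0 then 0 else h_number (d - 1) L (i - 1))) +
    int (d choose i) * ((-1) ^ (d + i) * (\<Sum>F\<in>K. (-1) ^ card F))"
proof -
  have manK: "homology_manifold_links TYPE('k) d K"
    and manL: "homology_manifold_links TYPE('k) (d - 1) L"
    using K B by (auto simp: homology_manifold_def L_def)
  note cK = homology_manifold_links_complex[OF manK] and cL = homology_manifold_links_complex[OF manL]
  have hK: "h_number d K m = coeff (h_poly d K) m" for m
    by (rule h_number_eq_coeff[OF face_complex_finite[OF cK(1)] pure_complex_card_le[OF cK(1,2)]])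
  have hL: "h_number (d - 1) L m = coeff (h_poly (d - 1) L) m" for m
    by (rule h_number_eq_coeff[OF face_complex_finite[OF cL(1)] pure_complex_card_le[OF cL(1,2)]])
  have const: "coeff (p * of_int a) i = coeff p i * a" for p :: "int poly" and a
    by (simp add: of_int_poly)
  have "h_number d K (d - i) = coeff (h_poly_rev d K) i"
    unfolding hK by (rule coeff_h_poly_rev[OF pure_complex_card_le[OF cK(1,2)] \<open>i \<le> d\<close>])
  also have "\<dots> = coeff (h_poly d K) i - coeff ([:1, -1:] * h_poly (d - 1) L) i +
      coeff ([:1, -1:] ^ d) i * ((-1) ^ d * (\<Sum>F\<in>K. (-1) ^ card F))"
    unfolding h_poly_dehn_sommerville[OF K B, folded L_def] coeff_add coeff_diff const ..
  \<comment> \<open>Multiplication by 1 - x takes differences of consecutive coefficients, which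
    produces the uncorrected \<open>g\<close>-number of the boundary.\<close>
  also have "coeff ([:1, -1:] * h_poly (d - 1) L) i =
      h_number (d - 1) L i - (if i = 0 then 0 else h_number (d - 1) L (i - 1))"
    unfolding hL by (cases i) simp_all
  finally show ?thesis
    by (simp add: hK coeff_one_minus_x_power power_add mult_ac)
qed

text \<open>With the sign pulled out, sums truncated at different \<open>m\<close> become
  comparable. Index 0, standing for degree -1, may join because \<open>b 0 = 0\<close>.\<close>

lemma alternating_sum_eq:
  fixes b :: "nat \<Rightarrow> int"
  assumes "b 0 = 0"
  shows "(\<Sum>j\<in>{1..<m}. (-1) ^ (m - j - 1) * b j) = - ((-1) ^ m * (\<Sum>j<m. (-1) ^ j * b j))"
proof -
  have "(\<Sum>j\<in>{1..<m}. (-1) ^ (m - j - 1) * b j) = (\<Sum>j\<in>{1..<m}. - ((-1) ^ m * ((-1) ^ j * b j)))"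
  proof (rule sum.cong[OF refl])
    fix j assume "j \<in> {1..<m}"
    then have "m - j - 1 = m - Suc j" "Suc j \<le> m" by auto
    then show "(-1) ^ (m - j - 1) * b j = - ((-1) ^ m * ((-1) ^ j * b j))"
      by (simp add: minus_one_power_diff)
  qed
  also have "\<dots> = (\<Sum>j<m. - ((-1) ^ m * ((-1) ^ j * b j)))"
    using assms by (intro sum.mono_neutral_left) (auto simp: not_less_eq_eq)
  finally show ?thesis
    by (simp add: sum_negf sum_distrib_left)
qed

text \<open>The left side is the alternating sum of \<open>b (d - k)\<close> over
  \<open>k < i\<close>. Replacing each term through \<open>dual\<close> and \<open>exact\<close>
  makes the values of \<open>p\<close> telescope to \<open>p 0\<close> and
  \<open>p i\<close>.\<close>

lemma alternating_sum_duality: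
  fixes b c p r :: "nat \<Rightarrow> int"
  assumes "p 0 = 0" and "i \<le> d"
    and exact: "\<And>k. k < i \<Longrightarrow> r (Suc k) = p (Suc k) + p k + c k - b k"
    and dual: "\<And>k. k < i \<Longrightarrow> r (Suc k) = b (d - k)"
  shows "(-1) ^ d * ((\<Sum>j\<le>d. (-1) ^ j * b j) - (\<Sum>j\<le>d - i. (-1) ^ j * b j)) =
    - (\<Sum>j<i. (-1) ^ j * (b j - c j)) - (-1) ^ i * p i"
  using assms(2-)
proof (induction i)
  case 0
  then show ?case using assms(1) by simp
next
  case (Suc i)
  have "d - i = Suc (d - Suc i)" using Suc.prems(1) by simp
  then have "(\<Sum>j\<le>d - i. (-1) ^ j * b j) =
      (\<Sum>j\<le>d - Suc i. (-1) ^ j * b j) + (-1) ^ (d - i) * b (d - i)"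
    by (simp only: sum.atMost_Suc)
  moreover have "(-1 :: int) ^ d * (-1) ^ (d - i) = (-1) ^ i"
    using Suc.prems(1) by (simp add: minus_one_power_diff)
  moreover have "b (d - i) = p (Suc i) + p i + c i - b i"
    using Suc.prems(2,3)[of i] by simp
  moreover have "(-1) ^ d * ((\<Sum>j\<le>d. (-1) ^ j * b j) - (\<Sum>j\<le>d - i. (-1) ^ j * b j)) =
    - (\<Sum>j<i. (-1) ^ j * (b j - c j)) - (-1) ^ i * p i"
    using Suc by simp
  \<comment> \<open>Here \<open>w\<close>, \<open>u\<close>, \<open>e\<close> are the signs for
    \<open>d\<close>, \<open>d - i\<close>, \<open>i\<close>, and \<open>q\<close>,
    \<open>p'\<close> are \<open>p i\<close>, \<open>p (Suc i)\<close>; the new term cancels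
    \<open>q\<close> and leaves \<open>p'\<close>.\<close>
  moreover have "t = t' + u * v \<Longrightarrow> w * u = e \<Longrightarrow> v = p' + q + y - x \<Longrightarrow>
      w * (s - t) = - z - e * q \<Longrightarrow> w * (s - t') = - (z + e * (x - y)) - (-1) * e * p'"
    for t t' u v w e p' q x y s z :: int
    by Groebner_Basis.algebra
  ultimately show ?case
    unfolding sum.lessThan_Suc power_Suc by blast
qed

text \<open>The complexes \<open>{{}}\<close> and \<open>{}\<close> differ only in degree -1,
  whereas homology in degree \<open>m\<close> uses chains of the subcomplex in degrees
  \<open>m - 1\<close> and \<open>m\<close>.\<close>

lemma unreduced_homology_eq:
  assumes "m \<ge> 1"
  shows "unreduced_homology m K = (reduced_homology m K :: ('k::field, 'k chain set) module)"
proof -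
  have "chains j {{}} = (chains j {} :: 'k chain set)" if "j \<ge> 0" for j
    using that unfolding chains_empty by (intro chains_singleton) auto
  then show ?thesis
    using assms by (simp add: rel_homology_def relcycles_def relboundaries_def)
qed

theorem theorem3p2:
  fixes \<Delta> :: "nat set set" and n d i :: nat
  assumes "infinite (UNIV :: 'k::field set)"
    and "simplicial_complex_on {1..n} \<Delta>"
    and "homology_manifold TYPE('k) d \<Delta>"
    and "boundary_faces TYPE('k) d \<Delta> \<noteq> {}"
    and "orientable TYPE('k) d \<Delta>"
    and "i < d"
  shows "h'_number TYPE('k) d \<Delta> (d - i)
        - int (d choose (d - i)) * int (betti TYPE('k) (int d - int i - 1) \<Delta>)
      = h'_number TYPE('k) d \<Delta> i
        - g_bar TYPE('k) (d - 1) (boundary_complex TYPE('k) d \<Delta>) i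
        - int (d choose i)
          * int (dim_im_psi TYPE('k) (int i - 1) \<Delta> (boundary_complex TYPE('k) d \<Delta>))"
proof -
  define L where "L = boundary_complex TYPE('k) d \<Delta>"
  have manK: "homology_manifold_links TYPE('k) d \<Delta>"
    and manL: "homology_manifold_links TYPE('k) (d - 1) L"
    using assms(3,4) by (auto simp: homology_manifold_def L_def)
  note cK = homology_manifold_links_complex[OF manK] and cL = homology_manifold_links_complex[OF manL]
  have LK: "L \<subseteq> \<Delta>"
    using cK(3) by (auto simp: L_def boundary_complex_def boundary_faces_def)
  obtain F v where F: "F \<in> L" "v \<in> F"
    using assms(4) by (auto simp: L_def boundary_complex_def boundary_faces_def)
  then have vL: "{v} \<in> L"
    using cL(1) by (auto simp: face_complex_def)
  \<comment> \<open>Indices are shifted by one, so that 0 stands for degree -1.\<close>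
  define b where "b j = int (betti TYPE('k) (int j - 1) \<Delta>)" for j
  define c where "c j = int (betti TYPE('k) (int j - 1) L)" for j
  define p where "p j = int (dim_im_psi TYPE('k) (int j - 1) \<Delta> L)" for j
  define r where "r j = int (vectorspace.dim class_ring
    (rel_homology (int j - 1) \<Delta> L :: ('k, 'k chain set) module))" for j
  have b0: "b 0 = 0" and c0: "c 0 = 0"
    using betti_minus_one[OF cK(1), of v] betti_minus_one[OF cL(1) vL] vL LK
    by (auto simp: b_def c_def)
  have p0: "p 0 = 0"
    using dim_im_psi_le_betti[OF cK(1) cL(1) LK, of "-1", where 'k = 'k] b0 by (simp add: b_def p_def)
  have exact: "r (Suc k) = p (Suc k) + p k + c k - b k" for k
    using rel_homology_dim[OF cK(1) cL(1) LK, of "int k", where 'k = 'k]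
    by (simp add: r_def p_def b_def c_def)
  have dual: "r (Suc k) = b (d - k)" if "k < i" for k
  proof -
    \<comment> \<open>From \<open>k < i < d\<close> the dual degree \<open>d - k - 1\<close> is at
      least 1, so the unreduced homology in \<open>orientable\<close> may be replaced by reduced
      homology.\<close>
    have k: "Suc k \<in> {1..d}" "int d - int (Suc k) \<ge> 1" "int d - int (Suc k) = int (d - k) - 1"
      using that assms(6) by auto
    have "iso_spaces (rel_homology (int (Suc k) - 1) \<Delta> L :: ('k, 'k chain set) module)
        (reduced_homology (int (d - k) - 1) \<Delta> :: ('k, 'k chain set) module)"
      using assms(5) k(1) unreduced_homology_eq[OF k(2), of \<Delta>, where 'k = 'k]
      unfolding orientable_def L_def[symmetric] k(3) by (metis k(3))
    then show ?thesis
      using iso_spaces_dim[OF _ rel_homology_vectorspace(1)[OF cK(1) cL(1) LK]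
          reduced_homology_vectorspace(1)[OF cK(1)] rel_homology_vectorspace(2)[OF cK(1) cL(1) LK]]
      unfolding r_def b_def betti_def by metis
  qed
  have duality: "(-1) ^ d * ((\<Sum>j\<le>d. (-1) ^ j * b j) - (\<Sum>j\<le>d - i. (-1) ^ j * b j)) =
    - (\<Sum>j<i. (-1) ^ j * (b j - c j)) - (-1) ^ i * p i"
    by (rule alternating_sum_duality[OF p0 _ exact dual]) (use assms(6) in auto)
  have euler: "(\<Sum>F\<in>\<Delta>. (-1) ^ card F) = (\<Sum>j\<le>d. (-1) ^ j * b j)"
    unfolding b_def by (rule euler_poincare[OF cK(1) pure_complex_card_le[OF cK(1,2)], symmetric])
  have h'K: "h'_number TYPE('k) d \<Delta> m =
      h_number d \<Delta> m - int (d choose m) * ((-1) ^ m * (\<Sum>j<m. (-1) ^ j * b j))" for m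
    unfolding h'_number_def using alternating_sum_eq[of b m, OF b0] by (simp add: b_def)
  have h'L: "h'_number TYPE('k) (d - 1) L m =
      h_number (d - 1) L m - int (d - 1 choose m) * ((-1) ^ m * (\<Sum>j<m. (-1) ^ j * c j))" for m
    unfolding h'_number_def using alternating_sum_eq[of c m, OF c0] by (simp add: c_def)
  \<comment> \<open>The Betti correction in \<open>g_bar\<close> extends the sum for
    \<open>i - 1\<close> to all \<open>j < i\<close>; Pascal's rule then adds the two binomial
    coefficients.\<close>
  have g: "g_bar TYPE('k) (d - 1) L i =
      (h_number (d - 1) L i - (if i = 0 then 0 else h_number (d - 1) L (i - 1))) -
      int (d choose i) * ((-1) ^ i * (\<Sum>j<i. (-1) ^ j * c j))"
  proof (cases i)
    case 0
    then show ?thesis unfolding g_bar_def h'L by simp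
  next
    case (Suc m)
    then obtain e where e: "d = Suc e" using assms(6) by (cases d) auto
    have "int (betti TYPE('k) (int i - 2) L) = c m"
      by (simp add: c_def Suc)
    then show ?thesis
      unfolding g_bar_def h'L by (simp add: Suc e algebra_simps)
  qed
  have "int d - int i - 1 = int (d - i) - 1" using assms(6) by simp
  then have bd: "int (betti TYPE('k) (int d - int i - 1) \<Delta>) = b (d - i)"
    by (simp only: b_def)
  have sgn: "(-1 :: int) ^ (d - i) = (-1) ^ d * (-1) ^ i"
    using assms(6) by (simp add: minus_one_power_diff)
  \<comment> \<open>The last term is the Betti number subtracted on the left of the theorem.\<close>
  have atMost: "(\<Sum>j\<le>d - i. (-1) ^ j * b j) = (\<Sum>j<d - i. (-1) ^ j * b j) + (-1) ^ (d - i) * b (d - i)"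
    by (simp add: lessThan_Suc_atMost[symmetric])
  have sq: "(-1 :: int) ^ m * (-1) ^ m = 1" for m
    by simp
  have binom: "d choose (d - i) = d choose i"
    using assms(6) by (simp add: binomial_symmetric[symmetric])
  have hDS: "h_number d \<Delta> (d - i) =
    h_number d \<Delta> i - (h_number (d - 1) L i - (if i = 0 then 0 else h_number (d - 1) L (i - 1))) +
    int (d choose i) * ((-1) ^ (d + i) * (\<Sum>j\<le>d. (-1) ^ j * b j))"
    using h_number_dehn_sommerville[OF assms(3,4), of i] assms(6) by (simp add: L_def euler)
  have diff: "(\<Sum>j<i. (-1) ^ j * (b j - c j)) = (\<Sum>j<i. (-1) ^ j * b j) - (\<Sum>j<i. (-1) ^ j * c j)"
    by (simp add: right_diff_distrib sum_subtractf)
  \<comment> \<open>\<open>s\<close> and \<open>e\<close> are the signs for \<open>d\<close> and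
    \<open>i\<close>, \<open>a\<close> is the full sum of \<open>b\<close>, \<open>t\<close> its
    part below \<open>d - i\<close> and \<open>v\<close> the next Betti number; \<open>x\<close> and
    \<open>y\<close> are the sums of \<open>b\<close> and \<open>c\<close> below \<open>i\<close>,
    and \<open>q\<close> is the rank of \<psi>.\<close>
  have final: "s * (a - (t + s * e * v)) = - (x - y) - e * q \<Longrightarrow> s * s = 1 \<Longrightarrow> e * e = 1 \<Longrightarrow>
      h - g + m * (s * e * a) - m * (s * e * t) - m * v =
      h - m * (e * x) - (g - m * (e * y)) - m * q" for s a t e v x y q h g m :: int
    by Groebner_Basis.algebra
  show ?thesis
    unfolding L_def[symmetric] bd h'K g hDS binom
    using duality unfolding diff atMost power_add sgn p_def[symmetric]
    by (rule final[OF _ sq sq])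
qed

end
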